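(* Let $S$ be an ordered semigroup satisfying axioms O1–O6 and with a countable dense subset. (i) For each pair $f,g\in S_{\mathbb{R}}$ there exists a greatest lower bound $f\wedge g$ in $S_{\mathbb{R}}$. (ii) For any $f\in S_{\mathbb{R}}$ and any increasing sequence $(g_n)$ in $S_{\mathbb{R}}$ we have $\sup_n (f\wedge g_n)=f\wedge (\sup_n g_n)$. (iii) For all $f,g,h\in S_{\mathbb{R}}$ we have $(f\wedge g)+h=(f+h)\wedge (g+h)$.
   Context: An ordered semigroup is an abelian monoid with a translation invariant order relation in which $0$ is the smallest element. For $s,t$ in an ordered set, $s\ll t$ means: for every increasing sequence $(t_n)$ (having a supremum) with $t\leq \sup_n t_n$ there is $n_0$ with $s\leq t_{n_0}$. Axioms on an ordered semigroup $S$: O1: every increasing sequence has a supremum. O2: every $s\in S$ is the supremum of a sequence $(s_n)$ with $s_n\ll s_{n+1}$ for all $n$. O3: if $s_i\ll t_i$ for $i=1,2$ then $s_1+s_2\ll t_1+t_2$. O4: if $(s_n),(t_n)$ are increasing then $\sup_n(s_n+t_n)=\sup_n s_n+\sup_n t_n$. O5: if $s'\ll s\leq t$ then there exists $r$ with $s'+r\leq t\leq s+r$. O6: if $s\leq r+t$ then for every $s'\ll s$ there exist $r',t'$ with $s'\leq r'+t'$, $r'\leq r$, $r'\leq s$, $t'\leq t$, $t'\leq s$. A subset $S'\subseteq S$ is dense if every element of $S$ is the supremum of a sequence $(s_n)$ in $S'$ with $s_n\ll s_{n+1}$ for all $n$. A functional on $S$ is a map $\lambda\colon S\to[0,\infty]$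 that is additive, order preserving, sends $0$ to $0$, and preserves suprema of increasing sequences. $\mathrm{F}(S)$ is the cone of all functionals (pointwise operations), with the topology in which a net $(\lambda_i)$ converges to $\lambda$ iff $\limsup_i\lambda_i(s')\leq\lambda(s)\leq\liminf_i\lambda_i(s)$ for all $s',s\in S$ with $s'\ll s$. $\mathrm{Lsc}(\mathrm{F}(S))$ is the set of lower semicontinuous functions $f\colon\mathrm{F}(S)\to[0,\infty]$ that are linear (additive, homogeneous for positive real scalars, $f(0)=0$), with pointwise order and operations. For $s\in S$, $\hat s\in\mathrm{Lsc}(\mathrm{F}(S))$ is $\hat s(\lambda)=\lambda(s)$. $S_{\mathbb{R}}\subseteq \mathrm{Lsc}(\mathrm{F}(S))$ is the ordered semigroup of functions $f$ for which there are $s_i\in S$ and positive integers $n_i$ ($i=1,2,\dots$) such that $(\hat s_i/n_i)_i$ is increasing and $f(\lambda)=\sup_i \hat s_i(\lambda)/n_i$ for all $\lambda\in\mathrm{F}(S)$. *)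

theory Defs
  imports "HOL-Analysis.Analysis" "HOL-Library.Lub_Glb"
begin

class ordered_semigroup = ordered_comm_monoid_add +
  assumes zero_least: "0 \<le> a"

definition way_below :: "'a::order \<Rightarrow> 'a \<Rightarrow> bool"  (infix \<open>\<lless>\<close> 50)
  where "s \<lless> t \<longleftrightarrow>
    (\<forall>T u. incseq T \<and> isLub UNIV (range T) u \<and> t \<le> u \<longrightarrow> (\<exists>n::nat. s \<le> T n))"

definition axiom_O1 :: "'a::ordered_semigroup itself \<Rightarrow> bool"
  where "axiom_O1 _ \<longleftrightarrow>
    (\<forall>T::nat \<Rightarrow> 'a. incseq T \<longrightarrow> (\<exists>u. isLub UNIV (range T) u))"

definition axiom_O2 :: "'a::ordered_semigroup itself \<Rightarrow> bool"
  where "axiom_O2 _ \<longleftrightarrow>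
    (\<forall>s::'a. \<exists>T::nat \<Rightarrow> 'a. (\<forall>n. T n \<lless> T (Suc n)) \<and> isLub UNIV (range T) s)"

definition axiom_O3 :: "'a::ordered_semigroup itself \<Rightarrow> bool"
  where "axiom_O3 _ \<longleftrightarrow>
    (\<forall>s1 t1 s2 t2 :: 'a. s1 \<lless> t1 \<and> s2 \<lless> t2 \<longrightarrow> s1 + s2 \<lless> t1 + t2)"

definition axiom_O4 :: "'a::ordered_semigroup itself \<Rightarrow> bool"
  where "axiom_O4 _ \<longleftrightarrow>
    (\<forall>(T1::nat \<Rightarrow> 'a) T2 u1 u2. incseq T1 \<and> incseq T2 \<and>
      isLub UNIV (range T1) u1 \<and> isLub UNIV (range T2) u2 \<longrightarrow>
      isLub UNIV (range (\<lambda>n. T1 n + T2 n)) (u1 + u2))"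

definition axiom_O5 :: "'a::ordered_semigroup itself \<Rightarrow> bool"
  where "axiom_O5 _ \<longleftrightarrow>
    (\<forall>s' s t :: 'a. s' \<lless> s \<and> s \<le> t \<longrightarrow> (\<exists>r. s' + r \<le> t \<and> t \<le> s + r))"

definition axiom_O6 :: "'a::ordered_semigroup itself \<Rightarrow> bool"
  where "axiom_O6 _ \<longleftrightarrow>
    (\<forall>s r t s' :: 'a. s \<le> r + t \<and> s' \<lless> s \<longrightarrow>
      (\<exists>r' t'. s' \<le> r' + t' \<and> r' \<le> r \<and> r' \<le> s \<and> t' \<le> t \<and> t' \<le> s))"

definition dense_subset :: "'a::ordered_semigroup set \<Rightarrow> bool"
  where "dense_subset D \<longleftrightarrow>
    (\<forall>s. \<exists>T::nat \<Rightarrow> 'a. range T \<subseteq> D \<and> (\<forall>n. T n \<lless> T (Suc n)) \<and>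
      isLub UNIV (range T) s)"

definition is_functional :: "('a::ordered_semigroup \<Rightarrow> ennreal) \<Rightarrow> bool"
  where "is_functional l \<longleftrightarrow>
    (\<forall>s t. l (s + t) = l s + l t) \<and> mono l \<and> l 0 = 0 \<and>
    (\<forall>T u. incseq T \<and> isLub UNIV (range T) u \<longrightarrow> l u = (SUP n::nat. l (T n)))"

typedef (overloaded) ('a::ordered_semigroup) functional =
  "{l :: 'a \<Rightarrow> ennreal. is_functional l}"
  morphisms apply_functional Abs_functional
  by (rule exI[of _ "\<lambda>_. 0"]) (auto simp: is_functional_def mono_def)

setup_lifting type_definition_functional

instantiation functional :: (ordered_semigroup) comm_monoid_add
begin

lift_definition zero_functional :: "'a functional" is "\<lambda>_. 0"
  by (auto simp: is_functional_def mono_def)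

lift_definition plus_functional :: "'a functional \<Rightarrow> 'a functional \<Rightarrow> 'a functional"
  is "\<lambda>l m s. l s + m s"
proof -
  fix l m :: "'a \<Rightarrow> ennreal"
  assume l: "is_functional l" and m: "is_functional m"
  have "l u + m u = (SUP n::nat. l (T n) + m (T n))"
    if T: "incseq T" "isLub UNIV (range T) u" for T u
  proof -
    have "incseq (\<lambda>n. l (T n))" "incseq (\<lambda>n. m (T n))"
      using l m T(1) by (auto simp: is_functional_def mono_def)
    from ennreal_SUP_add[OF this] show ?thesis
      using l m T by (auto simp: is_functional_def)
  qed
  with l m show "is_functional (\<lambda>s. l s + m s)"
    unfolding is_functional_def by (auto simp: mono_def add_mono ac_simps)
qed

instance
  by standard (transfer; simp add: ac_simps)+

end

text \<open>Only used for \<open>c > 0\<close>.\<close>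

lift_definition scale_functional ::
  "real \<Rightarrow> 'a::ordered_semigroup functional \<Rightarrow> 'a functional"
  is "\<lambda>c l s. ennreal c * l s"
  by (auto simp: is_functional_def mono_def distrib_left SUP_mult_left_ennreal
      intro!: mult_left_mono)

definition functional_lim ::
  "('i \<Rightarrow> 'a::ordered_semigroup functional) \<Rightarrow> 'a functional \<Rightarrow> 'i filter \<Rightarrow> bool"
  where "functional_lim x l F \<longleftrightarrow>
    (\<forall>s' s. s' \<lless> s \<longrightarrow>
      Limsup F (\<lambda>i. apply_functional (x i) s') \<le> apply_functional l s \<and>
      apply_functional l s \<le> Liminf F (\<lambda>i. apply_functional (x i) s))"

text \<open>A set is open iff it eventually contains every net (here: filter) converging
  to one of its points. That the convergent nets of this topology are exactly those
  of \<^const>\<open>functional_lim\<close> is lemma \<open>tendsto_functional_iff\<close>.\<close>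

instantiation functional :: (ordered_semigroup) topological_space
begin

definition open_functional :: "'a functional set \<Rightarrow> bool"
  where "open_functional U \<longleftrightarrow>
    (\<forall>l\<in>U. \<forall>F. functional_lim (\<lambda>m. m) l F \<longrightarrow> eventually (\<lambda>m. m \<in> U) F)"

instance
proof
  show "open (UNIV :: 'a functional set)"
    by (simp add: open_functional_def)
next
  fix S T :: "'a functional set"
  assume "open S" "open T"
  then show "open (S \<inter> T)"
    by (auto simp: open_functional_def eventually_conj_iff)
next
  fix K :: "'a functional set set"
  assume "\<forall>S\<in>K. open S"
  then show "open (\<Union>K)"
    unfolding open_functional_def by (fastforce elim: eventually_mono)
qed

end

lemma functional_lim_iff:
  "functional_lim x l F \<longleftrightarrow>
    (\<forall>s' s. s' \<lless> s \<longrightarrow>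
      (\<forall>r > apply_functional l s. eventually (\<lambda>i. apply_functional (x i) s' < r) F) \<and>
      (\<forall>r < apply_functional l s. eventually (\<lambda>i. r < apply_functional (x i) s) F))"
  unfolding functional_lim_def Limsup_le_iff le_Liminf_iff ..

lemma way_below_mono:
  fixes a b c d :: "'a::order"
  assumes "a \<le> b" "b \<lless> c" "c \<le> d"
  shows "a \<lless> d"
  using assms unfolding way_below_def by (meson order_trans)

lemma way_below_imp_le:
  fixes a b :: "'a::order"
  assumes "a \<lless> b"
  shows "a \<le> b"
proof -
  have "incseq (\<lambda>_::nat. b)" "isLub UNIV (range (\<lambda>_::nat. b)) b"
    by (auto simp: isLub_def leastP_def isUb_def setle_def setge_def)
  with assms show ?thesis unfolding way_below_def by blast
qed

lemma way_below_interpolate: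
  fixes a b :: "'a::ordered_semigroup"
  assumes "axiom_O2 TYPE('a)" "a \<lless> b"
  obtains c where "a \<lless> c" "c \<lless> b"
proof -
  obtain T :: "nat \<Rightarrow> 'a" where T: "\<And>n. T n \<lless> T (Suc n)" "isLub UNIV (range T) b"
    using assms(1) unfolding axiom_O2_def by blast
  have "incseq T"
    by (rule incseq_SucI) (rule way_below_imp_le[OF T(1)])
  then obtain n where "a \<le> T n"
    using assms(2) T(2) unfolding way_below_def by blast
  then have "a \<lless> T (Suc n)"
    using T(1) way_below_mono by blast
  moreover have "T (Suc n) \<lless> b"
    using T(1)[of "Suc n"] isLubD2[OF T(2), of "T (Suc (Suc n))"] way_below_mono by blast
  ultimately show ?thesis by (rule that)
qed

lemma tendsto_functional_iff:
  fixes l :: "'a::ordered_semigroup functional"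
  assumes O2: "axiom_O2 TYPE('a)"
  shows "(x \<longlongrightarrow> l) F \<longleftrightarrow> functional_lim x l F"
proof
  assume lim: "(x \<longlongrightarrow> l) F"
  have "eventually (\<lambda>i. apply_functional (x i) s' < r) F"
    if "s' \<lless> s" "apply_functional l s < r" for s' s r
  proof -
    let ?U = "{m. \<exists>t. s' \<lless> t \<and> apply_functional m t < r}"
    have "open ?U"
      unfolding open_functional_def
    proof (intro ballI allI impI)
      fix m G
      assume "m \<in> ?U" and m: "functional_lim (\<lambda>m. m) m G"
      then obtain t where t: "s' \<lless> t" "apply_functional m t < r" by blast
      obtain t' where t': "s' \<lless> t'" "t' \<lless> t"
        using way_below_interpolate[OF O2 t(1)] .
      have "eventually (\<lambda>n. apply_functional n t' < r) G"
        using m t(2) t'(2) unfolding functional_lim_iff by blast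
      then show "eventually (\<lambda>n. n \<in> ?U) G"
        by (rule eventually_mono) (use t'(1) in blast)
    qed
    moreover have "l \<in> ?U" using that by blast
    ultimately have "eventually (\<lambda>i. x i \<in> ?U) F"
      using lim by (rule topological_tendstoD[rotated])
    then show ?thesis
    proof (rule eventually_mono)
      fix i assume "x i \<in> ?U"
      then obtain t where t: "s' \<lless> t" "apply_functional (x i) t < r" by blast
      have "apply_functional (x i) s' \<le> apply_functional (x i) t"
        using apply_functional[of "x i"] way_below_imp_le[OF t(1)]
        by (auto simp: is_functional_def mono_def)
      with t(2) show "apply_functional (x i) s' < r" by simp
    qed
  qed
  moreover have "eventually (\<lambda>i. r < apply_functional (x i) s) F"
    if "s' \<lless> s" "r < apply_functional l s" for s' s r
  proof -
    have "open {m. r < apply_functional m s}"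
      using that(1) by (auto simp: open_functional_def functional_lim_iff)
    with lim that(2) show ?thesis
      using topological_tendstoD by fastforce
  qed
  ultimately show "functional_lim x l F"
    unfolding functional_lim_iff by blast
next
  assume "functional_lim x l F"
  then have "functional_lim (\<lambda>m. m) l (filtermap x F)"
    by (simp add: functional_lim_iff eventually_filtermap)
  then have "eventually (\<lambda>m. m \<in> S) (filtermap x F)" if "open S" "l \<in> S" for S
    using that unfolding open_functional_def by blast
  then show "(x \<longlongrightarrow> l) F"
    by (simp add: tendsto_def eventually_filtermap)
qed

definition Lsc_functional :: "('a::ordered_semigroup functional \<Rightarrow> ennreal) set"
  where "Lsc_functional = {f.
    (\<forall>r. open {l. r < f l}) \<and>
    (\<forall>l m. f (l + m) = f l + f m) \<and>
    (\<forall>c>0. \<forall>l. f (scale_functional c l) = ennreal c * f l) \<and>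
    f 0 = 0}"

definition hat :: "'a::ordered_semigroup \<Rightarrow> 'a functional \<Rightarrow> ennreal"
  where "hat s = (\<lambda>l. apply_functional l s)"

definition realification :: "('a::ordered_semigroup functional \<Rightarrow> ennreal) set"
  where "realification = {f \<in> Lsc_functional.
    \<exists>(s::nat \<Rightarrow> 'a) (k::nat \<Rightarrow> nat). (\<forall>i. 0 < k i) \<and>
      incseq (\<lambda>i l. hat (s i) l / of_nat (k i)) \<and>
      (\<forall>l. f l = (SUP i. hat (s i) l / of_nat (k i)))}"

text \<open>The infimum within the ordered set \<^const>\<open>realification\<close>; in general this is
  not the pointwise infimum \<^term>\<open>inf f g\<close>.\<close>

definition realification_inf ::
  "('a::ordered_semigroup functional \<Rightarrow> ennreal) \<Rightarrow> ('a functional \<Rightarrow> ennreal) \<Rightarrow>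
    ('a functional \<Rightarrow> ennreal)"  (infixl \<open>\<sqinter>\<^sub>R\<close> 70)
  where "f \<sqinter>\<^sub>R g = (THE h. isGlb realification {f, g} h)"

end

theory Submission
  imports Defs
begin

text \<open>
  A pointwise inequality \<open>\<lambda>(s) \<le> \<lambda>(t)\<close> between elements of \<open>S\<close> is turned
  into algebra by a Hahn-Banach argument: a sublinear map on \<open>S\<close> has an additive minorant with a
  prescribed value at one element, and regularising it along \<open>\<lless>\<close> gives a functional. Hence
  \<open>K p s' \<le> K q t\<close> for some \<open>K > 0\<close> whenever \<open>s' \<lless> s\<close> and \<open>p < q\<close>. The same
  argument shows that \<open>r s' / k\<close>, for \<open>s' \<lless> s\<close> and \<open>r < 1\<close>, is compact relative to
  \<open>s / k\<close> with respect to suprema of increasing sequences of functions. So O5 and O6 pass from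
  \<open>S\<close> to the pointwise ordered fractions \<open>s / k\<close>.

  The complements supplied by O5 are only approximate. Averaging a chain
  \<open>e\<^sub>0 \<lless> \<dots> \<lless> e\<^sub>n\<close> below \<open>f\<close> makes the error at most \<open>f / n\<close>, and errors of
  this size can be absorbed into the elements at hand. This yields Riesz decomposition and Riesz
  interpolation for fractions. By interpolation the common lower bounds of \<open>f\<close> and \<open>g\<close>
  are upward directed up to \<open>\<lless>\<close>; a countable dense subset makes their pointwise supremum the
  supremum of a sequence, so it is the infimum of \<open>f\<close> and \<open>g\<close>. Continuity of the infimum is
  compactness, and compatibility with addition is Riesz decomposition.
\<close>

section \<open>Additive minorants of sublinear maps\<close>

definition nmul :: "nat \<Rightarrow> 'a::comm_monoid_add \<Rightarrow> 'a"
  where "nmul n x = (\<Sum>i<n. x)"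

lemma nmul_0 [simp]: "nmul 0 x = 0"
  by (simp add: nmul_def)

lemma nmul_Suc: "nmul (Suc n) x = x + nmul n x"
  by (simp add: nmul_def add.commute)

lemma nmul_1 [simp]: "nmul (Suc 0) x = x"
  by (simp add: nmul_def)

lemma nmul_zero_right [simp]: "nmul n 0 = 0"
  by (simp add: nmul_def)

lemma nmul_add_left: "nmul (m + n) x = nmul m x + nmul n x"
  by (induction m) (simp_all add: nmul_Suc ac_simps)

lemma nmul_add_right: "nmul n (x + y) = nmul n x + nmul n y"
  by (simp add: nmul_def sum.distrib)

lemma nmul_nmul: "nmul m (nmul n x) = nmul (m * n) x"
  by (induction m) (simp_all add: nmul_Suc nmul_add_left)

lemma nmul_mono: "x \<le> y \<Longrightarrow> nmul n x \<le> nmul n y"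
  for x y :: "'a::ordered_comm_monoid_add"
  by (simp add: nmul_def sum_mono)

lemma le_add_left: "y \<le> x + y" and le_add_right: "y \<le> y + x"
  for x y :: "'a::ordered_semigroup"
  using add_mono[OF zero_least order_refl, of y x] add_mono[OF order_refl zero_least, of y x]
  by simp_all

lemma nmul_mono_left: "m \<le> n \<Longrightarrow> nmul m x \<le> nmul n x"
  for x :: "'a::ordered_semigroup"
  by (metis le_add_right le_iff_add nmul_add_left)

section \<open>Sublinear maps and infima of sums\<close>

definition sublinear_map :: "('a::ordered_semigroup \<Rightarrow> ennreal) \<Rightarrow> bool"
  where "sublinear_map q \<longleftrightarrow> mono q \<and> (\<forall>x y. q (x + y) \<le> q x + q y) \<and>
    (\<forall>n x. of_nat n * q x \<le> q (nmul n x)) \<and> q 0 = 0"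

lemma sublinear_mapD:
  assumes "sublinear_map q"
  shows "x \<le> y \<Longrightarrow> q x \<le> q y" "q (x + y) \<le> q x + q y"
    "of_nat n * q x \<le> q (nmul n x)" "q 0 = 0"
  using assms by (auto simp: sublinear_map_def mono_def)

text \<open>Subadditivity and \<open>q 0 = 0\<close> give the inequality missing from
  \<open>sublinear_map\<close>, which postulates only the half of homogeneity that they do not
  imply.\<close>

lemma sublinear_map_nmul:
  assumes "sublinear_map q"
  shows "q (nmul n x) = of_nat n * q x"
proof (rule antisym)
  show "q (nmul n x) \<le> of_nat n * q x"
  proof (induction n)
    case (Suc n)
    have "q (nmul (Suc n) x) \<le> q x + q (nmul n x)"
      using sublinear_mapD(2)[OF assms] by (simp add: nmul_Suc)
    also have "\<dots> \<le> of_nat (Suc n) * q x"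
      using Suc by (simp add: distrib_right add_left_mono)
    finally show ?case .
  qed (simp add: sublinear_mapD(4)[OF assms])
qed (rule sublinear_mapD(3)[OF assms])

lemma distrib_add_rearrange: "(a * c + u) + (b * c + v) = (a + b) * c + (u + v)"
  for a b c u v :: "'b::comm_semiring"
  by (simp add: distrib_right add_ac)

lemma INF_const_add_ennreal:
  fixes f :: "'b \<Rightarrow> ennreal"
  assumes "C \<noteq> {}"
  shows "(INF i\<in>C. c + f i) = c + (INF i\<in>C. f i)"
proof (rule antisym)
  show "(INF i\<in>C. c + f i) \<le> c + (INF i\<in>C. f i)"
  proof (cases "c = top")
    case fin: False
    have "(INF i\<in>C. c + f i) - c \<le> (INF i\<in>C. f i)"
  proof (rule INF_greatest)
    fix i assume "i \<in> C"
    then show "(INF i\<in>C. c + f i) - c \<le> f i"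
      using INF_lower[OF \<open>i \<in> C\<close>, of "\<lambda>i. c + f i"] fin by (auto simp: ennreal_minus_le_iff)
  qed
    then show ?thesis
      by (auto simp: ennreal_minus_le_iff)
  qed simp
qed (auto intro!: INF_greatest add_left_mono INF_lower)

lemma INF_add_const_ennreal:
  fixes f :: "'b \<Rightarrow> ennreal"
  shows "C \<noteq> {} \<Longrightarrow> (INF i\<in>C. f i + c) = (INF i\<in>C. f i) + c"
  using INF_const_add_ennreal[of C c f] by (simp add: add.commute)

text \<open>The Hahn-Banach modification of \<open>q\<close> in direction \<open>y\<close>. For
  sublinear \<open>q\<close> with \<open>q y\<close> finite the terms decrease in \<open>n\<close>,
  so the infimum is a limit; by \<open>slope_base\<close> the truncated subtraction cuts nothing
  off.\<close>

definition slope :: "'a::ordered_semigroup \<Rightarrow> ('a \<Rightarrow> ennreal) \<Rightarrow> 'a \<Rightarrow> ennreal"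
  where "slope y q x = (INF n. q (x + nmul n y) - of_nat n * q y)"

context
  fixes q :: "'a::ordered_semigroup \<Rightarrow> ennreal" and y :: 'a
  assumes q: "sublinear_map q" and fin: "q y < top"
begin

lemma slope_le: "slope y q x \<le> q x"
  unfolding slope_def by (rule INF_lower2[of 0]) auto

lemma of_nat_slope_fin: "of_nat n * q y < top"
  using fin by (simp add: ennreal_mult_less_top of_nat_less_top)

lemma slope_base: "of_nat n * q y \<le> q (x + nmul n y)"
  using sublinear_mapD(1)[OF q le_add_left, of "nmul n y" x] sublinear_mapD(3)[OF q]
  by (meson order_trans)

text \<open>Going from \<open>n\<close> to \<open>n + j\<close> raises the value of \<open>q\<close>
  by at most \<open>j\<close> times \<open>q y\<close>, by subadditivity, and exactly this amount is
  subtracted in addition.\<close>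

lemma slope_quotient_antimono:
  assumes "n \<le> m"
  shows "q (x + nmul m y) - of_nat m * q y \<le> q (x + nmul n y) - of_nat n * q y"
proof -
  obtain j where m: "m = n + j"
    using assms le_iff_add by blast
  have "q (x + nmul m y) \<le> q (x + nmul n y) + of_nat j * q y"
    using sublinear_mapD(2)[OF q, of "x + nmul n y" "nmul j y"]
    by (simp add: m nmul_add_left ac_simps sublinear_map_nmul[OF q])
  also have "\<dots> = of_nat m * q y + (q (x + nmul n y) - of_nat n * q y)"
  proof -
    define d where "d = q (x + nmul n y) - of_nat n * q y"
    have "q (x + nmul n y) + of_nat j * q y = (of_nat n * q y + d) + (of_nat j * q y + 0)"
      unfolding d_def by (simp only: add_diff_inverse_ennreal[OF slope_base] add_0_right)
    also have "\<dots> = of_nat m * q y + d"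
      unfolding distrib_add_rearrange by (simp add: m)
    finally show ?thesis
      by (simp only: d_def)
  qed
  finally show ?thesis
    using of_nat_slope_fin[of m] by (auto simp: ennreal_minus_le_iff)
qed

text \<open>For subadditivity, terms with indices \<open>n\<close> and \<open>m\<close> are compared
  with the term of index \<open>n + m\<close>. For multiples by \<open>k > 0\<close>, the term of
  index \<open>n\<close> is compared with that of index \<open>k * n\<close>, using that the terms
  decrease.\<close>

lemma slope_sublinear: "sublinear_map (slope y q)"
  unfolding sublinear_map_def
proof (intro conjI allI)
  show "mono (slope y q)"
    unfolding slope_def
    by (intro monoI INF_mono') (auto intro!: ennreal_minus_mono sublinear_mapD(1)[OF q] add_mono)
  show "slope y q 0 = 0"
    using sublinear_mapD(4)[OF q] slope_le[of 0] by simp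
  fix x x'
  have "slope y q (x + x') \<le>
      (q (x + nmul n y) - of_nat n * q y) + (q (x' + nmul m y) - of_nat m * q y)" for n m
  proof -
    have "q (x + x' + nmul (n + m) y) \<le> q (x + nmul n y) + q (x' + nmul m y)"
      using sublinear_mapD(2)[OF q, of "x + nmul n y" "x' + nmul m y"]
      by (simp add: nmul_add_left ac_simps)
    also have "\<dots> = (of_nat n * q y + (q (x + nmul n y) - of_nat n * q y))
        + (of_nat m * q y + (q (x' + nmul m y) - of_nat m * q y))"
      using slope_base[of n x] slope_base[of m x'] by (simp add: add_diff_inverse_ennreal)
    also have "\<dots> = of_nat (n + m) * q y +
        ((q (x + nmul n y) - of_nat n * q y) + (q (x' + nmul m y) - of_nat m * q y))"
      by (simp only: of_nat_add distrib_add_rearrange)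
    finally have "q (x + x' + nmul (n + m) y) - of_nat (n + m) * q y \<le>
        (q (x + nmul n y) - of_nat n * q y) + (q (x' + nmul m y) - of_nat m * q y)"
      using of_nat_slope_fin[of "n + m"] by (auto simp: ennreal_minus_le_iff)
    then show ?thesis
      unfolding slope_def by (rule INF_lower2[of "n + m", OF UNIV_I])
  qed
  then have "slope y q (x + x') \<le> (INF n. INF m.
      (q (x + nmul n y) - of_nat n * q y) + (q (x' + nmul m y) - of_nat m * q y))"
    by (intro INF_greatest)
  also have "\<dots> = slope y q x + slope y q x'"
    by (simp add: slope_def INF_const_add_ennreal INF_add_const_ennreal)
  finally show "slope y q (x + x') \<le> slope y q x + slope y q x'" .
next
  fix k x
  show "of_nat k * slope y q x \<le> slope y q (nmul k x)"
  proof (cases k)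
    case (Suc k')
    have "of_nat k * slope y q x \<le> q (nmul k x + nmul n y) - of_nat n * q y" for n
    proof -
      have "of_nat k * slope y q x \<le> of_nat k * (q (x + nmul n y) - of_nat n * q y)"
        unfolding slope_def by (intro mult_left_mono INF_lower) auto
      also have "\<dots> = of_nat k * q (x + nmul n y) - of_nat (k * n) * q y"
        using of_nat_slope_fin[of n] by (subst ennreal_right_diff_distrib) (auto simp: mult.assoc)
      also have "\<dots> \<le> q (nmul k x + nmul (k * n) y) - of_nat (k * n) * q y"
        using sublinear_mapD(3)[OF q, of k "x + nmul n y"]
        by (intro ennreal_minus_mono) (auto simp: nmul_add_right nmul_nmul)
      also have "\<dots> \<le> q (nmul k x + nmul n y) - of_nat n * q y"
        using Suc by (intro slope_quotient_antimono) auto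
      finally show ?thesis .
    qed
    then show ?thesis
      unfolding slope_def[of y q "nmul k x"] by (intro INF_greatest)
  qed simp
qed

text \<open>An index shift: the term of index \<open>n\<close> at \<open>x + y\<close> is the term
  of index \<open>Suc n\<close> at \<open>x\<close>, plus \<open>q y\<close>.\<close>

lemma slope_add: "slope y q x + q y \<le> slope y q (x + y)"
  unfolding slope_def[of y q "x + y"]
proof (rule INF_greatest)
  fix n
  have "slope y q x + q y \<le> (q (x + nmul (Suc n) y) - of_nat (Suc n) * q y) + q y"
    unfolding slope_def by (intro add_right_mono INF_lower) auto
  also have "\<dots> = q (x + y + nmul n y) - of_nat n * q y"
  proof -
    have "q (x + y + nmul n y) = of_nat (Suc n) * q y + (q (x + nmul (Suc n) y) - of_nat (Suc n) * q y)"
      using slope_base[of "Suc n" x] by (simp add: add_diff_inverse_ennreal nmul_Suc ac_simps)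
    also have "\<dots> = of_nat n * q y + ((q (x + nmul (Suc n) y) - of_nat (Suc n) * q y) + q y)"
      by (simp add: distrib_right add_ac)
    finally show ?thesis
      using of_nat_slope_fin[of n] by simp
  qed
  finally show "slope y q x + q y \<le> q (x + y + nmul n y) - of_nat n * q y" .
qed

text \<open>Each term of the infimum inherits the constraint at \<open>z\<close>. This makes
  \<open>slope y q\<close> a competitor in the minimality of \<open>q\<close>.\<close>

lemma slope_cong_add:
  assumes "\<And>x. q (z + x) = c + q x"
  shows "slope y q (z + x) = c + slope y q x"
proof -
  have "q (z + x + nmul n y) - of_nat n * q y = c + (q (x + nmul n y) - of_nat n * q y)" for n
    using slope_base[of n x] assms[of "x + nmul n y"] of_nat_slope_fin[of n]
    by (simp add: add_diff_eq_ennreal add.assoc)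
  then show ?thesis
    by (simp add: slope_def INF_const_add_ennreal)
qed

end

text \<open>Minimality among all sublinear minorants is useless, since \<open>0\<close> is one of them. The
  constraint \<open>q (z + x) = c + q x\<close> fixes the value at \<open>z\<close> and is inherited by infima of
  chains and by the maps \<open>slope y q\<close>.\<close>

lemma minimal_sublinear:
  fixes p :: "'a::ordered_semigroup \<Rightarrow> ennreal"
  assumes p: "sublinear_map p" and pz: "\<And>x. p (z + x) = c + p x"
  obtains q where "sublinear_map q" "q \<le> p" "\<And>x. q (z + x) = c + q x"
    "\<And>q'. sublinear_map q' \<Longrightarrow> q' \<le> q \<Longrightarrow> (\<And>x. q' (z + x) = c + q' x) \<Longrightarrow> q' = q"
proof -
  define A where "A = {q. sublinear_map q \<and> q \<le> p \<and> (\<forall>x. q (z + x) = c + q x)}"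
  have "\<exists>m\<in>A. \<forall>a\<in>A. m \<ge> a \<longrightarrow> a = m"
  \<comment> \<open>The order is reversed, so the maximal element supplied by Zorn's lemma is a
    minimal map.\<close>
  proof (rule predicate_Zorn)
    show "partial_order_on A (relation_of (\<ge>) A)"
      by (auto simp: partial_order_on_def preorder_on_def refl_on_def trans_def antisym_def
          relation_of_def)
    fix C assume C: "C \<in> Chains (relation_of (\<ge>) A)"
    then have CA: "C \<subseteq> A" and chain: "\<And>a b. a \<in> C \<Longrightarrow> b \<in> C \<Longrightarrow> a \<le> b \<or> b \<le> a"
      by (auto simp: Chains_def relation_of_def)
    show "\<exists>u\<in>A. \<forall>a\<in>C. a \<ge> u"
    proof (cases "C = {}")
      case True
      with p pz show ?thesis by (auto simp: A_def)
    next
      case False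
      define u where "u x = (INF q\<in>C. q x)" for x
      have sl: "sublinear_map q" if "q \<in> C" for q
        using that CA by (auto simp: A_def)
      have ul: "u \<le> q" if "q \<in> C" for q
        unfolding u_def le_fun_def using that by (auto intro: INF_lower)
      have "u \<in> A"
        unfolding A_def sublinear_map_def
      proof (intro CollectI conjI allI)
        show "mono u"
          unfolding u_def
        proof (intro monoI INF_mono)
          fix x y :: 'a and q assume "x \<le> y" "q \<in> C"
          then show "\<exists>q'\<in>C. q' x \<le> q y"
            using sublinear_mapD(1)[OF sl[of q], of x y] by blast
        qed
        show "u 0 = 0"
          using False by (simp add: u_def sublinear_mapD(4)[OF sl])
        show "u \<le> p"
        proof -
          obtain q where "q \<in> C"
            using False by blast
          then have "u \<le> q" "q \<le> p"
            using ul CA by (auto simp: A_def)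
          then show ?thesis
            by (rule order_trans)
        qed
        show "u (z + x) = c + u x" for x
        proof -
          have "u (z + x) = (INF q\<in>C. c + q x)"
            unfolding u_def using CA by (intro INF_cong) (auto simp: A_def)
          then show ?thesis
            using False by (simp add: u_def INF_const_add_ennreal)
        qed
        show "of_nat n * u x \<le> u (nmul n x)" for n x
          unfolding u_def[of "nmul n x"]
        proof (rule INF_greatest)
          fix q assume "q \<in> C"
          then have "of_nat n * u x \<le> of_nat n * q x"
            using ul by (intro mult_left_mono) (auto simp: le_fun_def)
          also have "\<dots> \<le> q (nmul n x)"
            using \<open>q \<in> C\<close> by (intro sublinear_mapD(3) sl)
          finally show "of_nat n * u x \<le> q (nmul n x)" .
        qed
        fix x y
        \<comment> \<open>Two members of the chain are replaced by the smaller one, whose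
          subadditivity handles both arguments at once.\<close>
        have "u (x + y) \<le> q x + q' y" if qq: "q \<in> C" "q' \<in> C" for q q'
        proof -
          obtain r where r: "r \<in> C" "r \<le> q" "r \<le> q'"
            using chain[OF qq] qq by blast
          have "u (x + y) \<le> r x + r y"
            using ul[OF r(1)] sublinear_mapD(2)[OF sl[OF r(1)], of x y]
            by (meson le_funD order_trans)
          also have "\<dots> \<le> q x + q' y"
            using r by (intro add_mono) (auto simp: le_fun_def)
          finally show ?thesis .
        qed
        then have "u (x + y) \<le> (INF q\<in>C. INF q'\<in>C. q x + q' y)"
          by (intro INF_greatest)
        also have "\<dots> = u x + u y"
          using False by (simp add: u_def INF_const_add_ennreal INF_add_const_ennreal)
        finally show "u (x + y) \<le> u x + u y" .
      qed
      with ul show ?thesis by blast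
    qed
  qed
  then show ?thesis
    using that unfolding A_def by auto
qed

text \<open>If \<open>p z\<close> is finite, \<open>slope z p\<close> satisfies the constraint at
  \<open>z\<close> with \<open>c = p z\<close>, and a minimal map below it is additive. If
  \<open>p z = top\<close>, the map that is \<open>top\<close> exactly where \<open>p\<close> is,
  and \<open>0\<close> elsewhere, is additive already.\<close>

lemma additive_minorant:
  fixes p :: "'a::ordered_semigroup \<Rightarrow> ennreal"
  assumes p: "sublinear_map p"
  obtains q where "mono q" "q 0 = 0" "\<And>x y. q (x + y) = q x + q y" "q \<le> p" "q z = p z"
proof (cases "p z = top")
  case True
  define q :: "'a \<Rightarrow> ennreal" where "q x = (if p x = top then top else 0)" for x
  have "p x + p y = top \<longleftrightarrow> p (x + y) = top" for x y
    using sublinear_mapD(2)[OF p, of x y] sublinear_mapD(1)[OF p le_add_left, of y x]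
      sublinear_mapD(1)[OF p le_add_right, of x y]
    by (auto simp: top_unique)
  then have "q (x + y) = q x + q y" for x y
    by (auto simp: q_def ennreal_add_eq_top)
  moreover have "mono q"
  proof (rule monoI)
    fix x y :: 'a assume "x \<le> y"
    then have "p x \<le> p y"
      by (rule sublinear_mapD(1)[OF p])
    then show "q x \<le> q y"
      by (auto simp: q_def top_unique)
  qed
  ultimately show ?thesis
    using that[of q] True sublinear_mapD(4)[OF p] by (auto simp: q_def le_fun_def)
next
  case False
  then have fin: "p z < top"
    by (simp add: less_top)
  let ?p = "slope z p"
  have p': "?p (z + x) = p z + ?p x" for x
  proof (rule antisym)
    have "?p (z + x) \<le> ?p z + ?p x"
      by (rule sublinear_mapD(2)[OF slope_sublinear[OF p fin]])
    also have "\<dots> \<le> p z + ?p x"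
      by (intro add_right_mono slope_le[OF p fin])
    finally show "?p (z + x) \<le> p z + ?p x" .
    show "p z + ?p x \<le> ?p (z + x)"
      using slope_add[OF p fin, of x] by (simp add: ac_simps)
  qed
  obtain q where q: "sublinear_map q" "q \<le> ?p" and qz: "\<And>x. q (z + x) = p z + q x"
    and min: "\<And>q'. sublinear_map q' \<Longrightarrow> q' \<le> q \<Longrightarrow> (\<And>x. q' (z + x) = p z + q' x) \<Longrightarrow> q' = q"
    using minimal_sublinear[OF slope_sublinear[OF p fin] p'] by metis
  have "q (x + y) = q x + q y" for x y
  proof (cases "q y = top")
    case True
    then show ?thesis
      using sublinear_mapD(1)[OF q(1) le_add_left, of y x] by (simp add: top_unique)
  next
    case False
    then have y: "q y < top"
      by (simp add: less_top)
    \<comment> \<open>Minimality applies because \<open>slope y q\<close> keeps the constraint at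
      \<open>z\<close>; \<open>slope_add\<close> then becomes superadditivity of \<open>q\<close> in
      direction \<open>y\<close>.\<close>
    have "slope y q = q"
      by (rule min[OF slope_sublinear[OF q(1) y] _ slope_cong_add[OF q(1) y qz]])
         (simp add: le_fun_def slope_le[OF q(1) y])
    then have "q x + q y \<le> q (x + y)"
      using slope_add[OF q(1) y, of x] by simp
    with sublinear_mapD(2)[OF q(1)] show ?thesis
      by (auto intro: antisym)
  qed
  moreover have "q \<le> p"
    using order_trans[OF q(2), of p] slope_le[OF p fin] by (simp add: le_fun_def)
  moreover have "q z = p z"
    using qz[of 0] sublinear_mapD(4)[OF q(1)] by simp
  ultimately show ?thesis
    using that[of q] q(1) by (simp add: sublinear_map_def)
qed

section \<open>Separation by functionals\<close>

lemma apply_functional_add: "apply_functional l (s + t) = apply_functional l s + apply_functional l t"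
  and apply_functional_mono: "s \<le> t \<Longrightarrow> apply_functional l s \<le> apply_functional l t"
  and apply_functional_0 [simp]: "apply_functional l 0 = 0"
  and apply_functional_SUP: "incseq T \<Longrightarrow> isLub UNIV (range T) u \<Longrightarrow>
    apply_functional l u = (SUP n::nat. apply_functional l (T n))"
  using apply_functional[of l] by (auto simp: is_functional_def mono_def)

lemma apply_functional_nmul: "apply_functional l (nmul n s) = of_nat n * apply_functional l s"
  by (induction n) (simp_all add: nmul_Suc apply_functional_add distrib_right)

lemma zero_way_below: "0 \<lless> s"
  for s :: "'a::ordered_semigroup"
  unfolding way_below_def using zero_least by blast

lemma divide_of_nat_ennreal: "0 < k \<Longrightarrow> x / of_nat k = ennreal (1 / real k) * x"
  by (simp add: divide_ennreal_def ennreal_of_nat_eq_real_of_nat inverse_ennreal divide_inverse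
      mult.commute)

lemma ennreal_mult_cancel_inverse: "0 < r \<Longrightarrow> ennreal r * (ennreal (1 / r) * x) = x"
  by (simp flip: mult.assoc ennreal_mult')

section \<open>The way-below relation and Hahn-Banach separation\<close>

locale cu_semigroup =
  fixes ty :: "'a::ordered_semigroup itself"
  assumes O2: "axiom_O2 TYPE('a)"
    and O3: "axiom_O3 TYPE('a)"
    and O4: "axiom_O4 TYPE('a)"
    and O5: "axiom_O5 TYPE('a)"
    and O6: "axiom_O6 TYPE('a)"
begin

lemma approx_seq:
  obtains T where "\<And>n. T n \<lless> T (Suc n)" "isLub UNIV (range T) (s::'a)" "incseq T"
    "\<And>n. T n \<lless> s"
proof -
  obtain T where T: "\<And>n. T n \<lless> T (Suc n)" "isLub UNIV (range T) s"
    using O2 unfolding axiom_O2_def by blast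
  moreover have "incseq T"
    by (rule incseq_SucI) (rule way_below_imp_le[OF T(1)])
  moreover have "T n \<lless> s" for n
    using way_below_mono[OF order_refl T(1)] isLubD2[OF T(2)] by blast
  ultimately show ?thesis
    using that by blast
qed

lemma way_below_add: "s \<lless> t \<Longrightarrow> s' \<lless> t' \<Longrightarrow> s + s' \<lless> t + t'"
  for s t :: 'a
  using O3 unfolding axiom_O3_def by blast

lemma way_below_nmul: "s \<lless> t \<Longrightarrow> nmul n s \<lless> nmul n t"
  for s t :: 'a
  by (induction n) (simp_all add: nmul_Suc zero_way_below way_below_add)

text \<open>By O4, the sums of sequences approximating \<open>x\<close> and \<open>y\<close>
  increase to \<open>x + y\<close>, so one of them dominates \<open>z\<close>.\<close>

lemma way_below_add_split:
  assumes "z \<lless> x + (y::'a)"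
  obtains x' y' where "x' \<lless> x" "y' \<lless> y" "z \<le> x' + y'"
proof -
  obtain T where T: "isLub UNIV (range T) x" "incseq T" "\<And>n. T n \<lless> x"
    using approx_seq[of x] by metis
  obtain U where U: "isLub UNIV (range U) y" "incseq U" "\<And>n. U n \<lless> y"
    using approx_seq[of y] by metis
  have "isLub UNIV (range (\<lambda>n. T n + U n)) (x + y)"
    using O4 T(1,2) U(1,2) unfolding axiom_O4_def by blast
  moreover have "incseq (\<lambda>n. T n + U n)"
    using T(2) U(2) by (auto simp: incseq_def add_mono)
  ultimately obtain n where "z \<le> T n + U n"
    using assms unfolding way_below_def by blast
  with T(3) U(3) that show ?thesis
    by blast
qed

text \<open>A monotone additive map need not preserve suprema; the supremum over elements way below
  repairs this. O3 and \<open>way_below_add_split\<close> give the two halves of additivity, and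
  interpolation gives preservation of suprema.\<close>

lemma is_functional_regularization:
  fixes q :: "'a \<Rightarrow> ennreal"
  assumes q: "mono q" "q 0 = 0" "\<And>x y. q (x + y) = q x + q y"
  shows "is_functional (\<lambda>x. SUP x'\<in>{x'. x' \<lless> x}. q x')"
  unfolding is_functional_def
proof (intro conjI allI impI)
  show "mono (\<lambda>x. SUP x'\<in>{x'. x' \<lless> x}. q x')"
    by (intro monoI SUP_subset_mono) (auto intro: way_below_mono)
  have "q x' = 0" if "x' \<lless> 0" for x'
    using way_below_imp_le[OF that] zero_least[of x'] q(2) by (simp add: antisym)
  then show "(SUP x'\<in>{x'. x' \<lless> 0}. q x') = 0"
    by (auto intro!: antisym SUP_least)
next
  fix s t :: 'a
  have ne: "{x'. x' \<lless> x} \<noteq> {}" for x :: 'a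
    using zero_way_below by blast
  show "(SUP x'\<in>{x'. x' \<lless> s + t}. q x') = (SUP x'\<in>{x'. x' \<lless> s}. q x') + (SUP x'\<in>{x'. x' \<lless> t}. q x')"
  proof (rule antisym)
    show "(SUP x'\<in>{x'. x' \<lless> s + t}. q x') \<le> (SUP x'\<in>{x'. x' \<lless> s}. q x') + (SUP x'\<in>{x'. x' \<lless> t}. q x')"
    proof (rule SUP_least)
      fix z assume "z \<in> {x'. x' \<lless> s + t}"
      then obtain x y where "x \<lless> s" "y \<lless> t" "z \<le> x + y"
        using way_below_add_split by blast
      then have "q z \<le> q x + q y"
        using monoD[OF q(1)] q(3) by metis
      also have "\<dots> \<le> (SUP x'\<in>{x'. x' \<lless> s}. q x') + (SUP x'\<in>{x'. x' \<lless> t}. q x')"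
        using \<open>x \<lless> s\<close> \<open>y \<lless> t\<close> by (auto intro!: add_mono SUP_upper)
      finally show "q z \<le> \<dots>" .
    qed
    have "(SUP x'\<in>{x'. x' \<lless> s}. q x') + (SUP x'\<in>{x'. x' \<lless> t}. q x') =
        (SUP x\<in>{x'. x' \<lless> s}. SUP y\<in>{x'. x' \<lless> t}. q x + q y)"
      by (simp only: ennreal_SUP_add_left[OF ne, symmetric] ennreal_SUP_add_right[OF ne])
        (rule SUP_commute)
    also have "\<dots> \<le> (SUP x'\<in>{x'. x' \<lless> s + t}. q x')"
      by (intro SUP_least) (auto simp flip: q(3) intro!: SUP_upper way_below_add)
    finally show "(SUP x'\<in>{x'. x' \<lless> s}. q x') + (SUP x'\<in>{x'. x' \<lless> t}. q x') \<le>
        (SUP x'\<in>{x'. x' \<lless> s + t}. q x')" .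
  qed
next
  fix T and u :: 'a
  assume T: "incseq T \<and> isLub UNIV (range T) u"
  show "(SUP x'\<in>{x'. x' \<lless> u}. q x') = (SUP n. SUP x'\<in>{x'. x' \<lless> T n}. q x')"
  proof (rule antisym)
    show "(SUP x'\<in>{x'. x' \<lless> u}. q x') \<le> (SUP n. SUP x'\<in>{x'. x' \<lless> T n}. q x')"
    proof (rule SUP_least)
      fix x assume "x \<in> {x'. x' \<lless> u}"
      then obtain y where y: "x \<lless> y" "y \<lless> u"
        using way_below_interpolate[OF O2] by blast
      then obtain n where "y \<le> T n"
        using T unfolding way_below_def by blast
      with y have "x \<lless> T n"
        using way_below_mono by blast
      then show "q x \<le> (SUP n. SUP x'\<in>{x'. x' \<lless> T n}. q x')"
        by (intro SUP_upper2[of n] SUP_upper) auto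
    qed
    have "T n \<le> u" for n
      using T isLubD2 by blast
    then show "(SUP n. SUP x'\<in>{x'. x' \<lless> T n}. q x') \<le> (SUP x'\<in>{x'. x' \<lless> u}. q x')"
      by (intro SUP_least SUP_upper) (auto intro: way_below_mono)
  qed
qed

text \<open>\<open>R r x\<close> stands for a statement of the form \<open>x \<le> r\<close>. The
  infimum \<open>p x\<close> of the admissible \<open>r\<close> is sublinear, and regularising an
  additive minorant of \<open>p\<close> yields a functional obeying all bounds in \<open>R\<close>,
  to which the hypothesis on \<open>z\<close> applies.\<close>

lemma functional_separation:
  fixes R :: "real \<Rightarrow> 'a \<Rightarrow> bool"
  assumes zero: "\<And>r. 0 < r \<Longrightarrow> R r 0"
    and add: "\<And>r s x y. 0 < r \<Longrightarrow> 0 < s \<Longrightarrow> R r x \<Longrightarrow> R s y \<Longrightarrow> R (r + s) (x + y)"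
    and mono: "\<And>r x y. x \<le> y \<Longrightarrow> R r y \<Longrightarrow> R r x"
    and scale: "\<And>n r x. 0 < n \<Longrightarrow> 0 < r \<Longrightarrow> R r (nmul n x) \<Longrightarrow> R (r / real n) x"
    and le: "\<And>l. (\<And>r y. 0 < r \<Longrightarrow> R r y \<Longrightarrow> apply_functional l y \<le> ennreal r) \<Longrightarrow>
      apply_functional l z \<le> 1"
    and "z' \<lless> z" "1 < c"
  obtains r where "0 < r" "r < c" "R r z'"
proof -
  define p where "p x = (INF r\<in>{r. 0 < r \<and> R r x}. ennreal r)" for x
  have p_le: "p x \<le> ennreal r" if "0 < r" "R r x" for r x
    unfolding p_def using that by (intro INF_lower) auto
  have p: "sublinear_map p"
    unfolding sublinear_map_def
  proof (intro conjI allI)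
    show "mono p"
      unfolding p_def by (intro monoI INF_superset_mono) (auto intro: mono)
    show "p 0 = 0"
    proof -
      have "p 0 \<le> 0"
        by (rule ennreal_le_epsilon) (use p_le zero in auto)
      then show ?thesis by simp
    qed
  next
    fix x y
    show "p (x + y) \<le> p x + p y"
    proof (cases "{r. 0 < r \<and> R r x} = {} \<or> {r. 0 < r \<and> R r y} = {}")
      case True
      moreover have "p w = top" if "{r. 0 < r \<and> R r w} = {}" for w
        unfolding p_def that by simp
      ultimately have "p x = top \<or> p y = top"
        by blast
      then show ?thesis by auto
    next
      case False
      have "p (x + y) \<le> ennreal r + ennreal s" if "0 < r" "R r x" "0 < s" "R s y" for r s
        using p_le[OF _ add[OF that(1,3,2,4)]] that by (simp add: ennreal_plus)
      then have "p (x + y) \<le> (INF r\<in>{r. 0 < r \<and> R r x}. INF s\<in>{r. 0 < r \<and> R r y}. ennreal r + ennreal s)"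
        by (intro INF_greatest) auto
      also have "\<dots> = p x + p y"
        using False by (simp add: p_def INF_const_add_ennreal INF_add_const_ennreal)
      finally show ?thesis .
    qed
  next
    fix n x
    show "of_nat n * p x \<le> p (nmul n x)"
    proof (cases "n = 0")
      case False
      show ?thesis
        unfolding p_def[of "nmul n x"]
      proof (rule INF_greatest)
        fix r assume "r \<in> {r. 0 < r \<and> R r (nmul n x)}"
        then have "of_nat n * p x \<le> of_nat n * ennreal (r / real n)"
          using False by (intro mult_left_mono p_le scale) auto
        also have "\<dots> = ennreal r"
          using False by (simp add: ennreal_of_nat_eq_real_of_nat flip: ennreal_mult')
        finally show "of_nat n * p x \<le> ennreal r" .
      qed
    qed simp
  qed
  \<comment> \<open>The value is prescribed at \<open>z'\<close> and not at \<open>z\<close>,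
    because regularisation may lower values: at \<open>z\<close> the regularised map is only known
    to be at least \<open>q z'\<close>. Hence \<open>p z' \<le> 1 < c\<close>.\<close>
  obtain q where q: "mono q" "q 0 = 0" "\<And>x y. q (x + y) = q x + q y" "q \<le> p" "q z' = p z'"
    using additive_minorant[OF p, of z'] by metis
  define l where "l = Abs_functional (\<lambda>x. SUP x'\<in>{x'. x' \<lless> x}. q x')"
  have l: "apply_functional l x = (SUP x'\<in>{x'. x' \<lless> x}. q x')" for x
    unfolding l_def using is_functional_regularization[OF q(1-3)]
    by (simp add: Abs_functional_inverse)
  have "apply_functional l y \<le> ennreal r" if "0 < r" "R r y" for r y
  proof -
    have "apply_functional l y \<le> q y"
      unfolding l using q(1) by (auto intro!: SUP_least dest: way_below_imp_le simp: mono_def)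
    also have "\<dots> \<le> ennreal r"
      using q(4) p_le[OF that] by (meson le_funD order_trans)
    finally show ?thesis .
  qed
  then have "apply_functional l z \<le> 1"
    by (rule le)
  moreover have "q z' \<le> apply_functional l z"
    unfolding l using \<open>z' \<lless> z\<close> by (intro SUP_upper) auto
  ultimately have "p z' < ennreal c"
    using q(5) \<open>1 < c\<close> by (metis ennreal_1 ennreal_lessI le_less_trans order_trans zero_less_one
        order.strict_trans)
  then show ?thesis
    unfolding p_def INF_less_iff using that by (auto simp: ennreal_less_iff)
qed

text \<open>Separation with \<open>R r x\<close> saying that \<open>M x \<le> N t\<close> for some
  \<open>N / M \<le> r\<close>. As \<open>R 1 t\<close> holds, a functional obeying \<open>R\<close>
  is at most \<open>1\<close> at \<open>t\<close>, hence at \<open>s\<close>. The gap between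
  \<open>p\<close> and \<open>q\<close> gives the room \<open>c = q / p\<close>.\<close>

lemma way_below_multiples:
  fixes s t :: 'a
  assumes st: "hat s \<le> hat t" and "s' \<lless> s" "p < (q::nat)"
  obtains K where "0 < K" "nmul (K * p) s' \<le> nmul (K * q) t"
proof (cases "p = 0")
  case True
  then show ?thesis
    using that[of 1] zero_least[of "nmul q t"] by simp
next
  case False
  define R :: "real \<Rightarrow> 'a \<Rightarrow> bool"
    where "R r x \<longleftrightarrow> (\<exists>M N. 0 < M \<and> real N \<le> r * real M \<and> nmul M x \<le> nmul N t)" for r x
  have "\<exists>r. 0 < r \<and> r < real q / real p \<and> R r s'"
  proof (rule functional_separation[of R s s' "real q / real p"])
    show "R r 0" if "0 < r" for r
      unfolding R_def using that by (intro exI[of _ 1] exI[of _ 0]) auto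
    show "R r x" if "x \<le> y" "R r y" for r x y
      using that order_trans[OF nmul_mono] unfolding R_def by blast
    show "R (r / real n) x" if R: "0 < n" "0 < r" "R r (nmul n x)" for n r x
    proof -
      obtain M N where "0 < M" "real N \<le> r * real M" "nmul M (nmul n x) \<le> nmul N t"
        using R(3) unfolding R_def by blast
      then show ?thesis
        unfolding R_def using that by (intro exI[of _ "M * n"] exI[of _ N]) (auto simp: nmul_nmul)
    qed
    show "R (r + s) (x + y)" if R: "R r x" "R s y" for r s x y
    proof -
      obtain M N where M: "0 < M" "real N \<le> r * real M" "nmul M x \<le> nmul N t"
        using R(1) unfolding R_def by blast
      obtain M' N' where M': "0 < M'" "real N' \<le> s * real M'" "nmul M' y \<le> nmul N' t"
        using R(2) unfolding R_def by blast
      have "nmul (M' * M) x \<le> nmul (M' * N) t" "nmul (M * M') y \<le> nmul (M * N') t"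
        using nmul_mono[OF M(3), of M'] nmul_mono[OF M'(3), of M] by (simp_all add: nmul_nmul)
      then have "nmul (M * M') (x + y) \<le> nmul (M' * N + M * N') t"
        by (simp add: nmul_add_right nmul_add_left add_mono mult.commute)
      moreover have "real (M' * N + M * N') \<le> (r + s) * real (M * M')"
        using mult_left_mono[OF M(2), of "real M'"] mult_left_mono[OF M'(2), of "real M"]
        by (simp add: algebra_simps)
      ultimately show ?thesis
        unfolding R_def using M(1) M'(1) by (metis nat_0_less_mult_iff)
    qed
    show "apply_functional l s \<le> 1"
      if "\<And>r y. 0 < r \<Longrightarrow> R r y \<Longrightarrow> apply_functional l y \<le> ennreal r" for l
    proof -
      have "R 1 t"
        unfolding R_def by (intro exI[of _ 1]) auto
      then have "apply_functional l t \<le> 1"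
        using that[of 1 t] by simp
      then show ?thesis
        using st by (auto simp: hat_def le_fun_def intro: order_trans)
    qed
    show "1 < real q / real p"
      using \<open>p < q\<close> False by simp
  qed (use \<open>s' \<lless> s\<close> in auto)
  then obtain r M N where r: "r < real q / real p" "0 < M" "real N \<le> r * real M"
    "nmul M s' \<le> nmul N t"
    unfolding R_def by blast
  show ?thesis
  \<comment> \<open>The multiplier will be \<open>K = N\<close>, which has to be positive. If
    \<open>N = 0\<close>, then \<open>s' \<le> 0\<close> and \<open>K = 1\<close> works.\<close>
  proof (cases "N = 0")
    case True
    have "s' \<le> nmul M s'"
      using nmul_mono_left[of 1 M s'] r(2) by simp
    then have "s' \<le> 0"
      using r(4) True by simp
    then have "nmul (1 * p) s' \<le> nmul (1 * q) t"
      using nmul_mono[of s' 0 p] zero_least[of "nmul q t"] by simp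
    then show ?thesis
      using that[of 1] by simp
  next
    case N: False
    have "real N * real p \<le> real q * real M"
    proof -
      have "real N * real p \<le> (r * real p) * real M"
        using r(3) mult_right_mono[of "real N" "r * real M" "real p"] by (simp add: ac_simps)
      also have "\<dots> \<le> real q * real M"
        using r(1) False by (intro mult_right_mono) (auto simp: field_simps)
      finally show ?thesis .
    qed
    then have "N * p \<le> q * M"
      by (simp flip: of_nat_mult)
    then have "nmul (N * p) s' \<le> nmul q (nmul M s')"
      by (simp add: nmul_nmul nmul_mono_left)
    also have "\<dots> \<le> nmul q (nmul N t)"
      using r(4) by (rule nmul_mono)
    finally show ?thesis
      using that[of N] N by (simp add: nmul_nmul mult.commute)
  qed
qed

text \<open>Compactness by separation, with \<open>R r x\<close> saying that \<open>hat x\<close> is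
  below \<open>r\<close> times some \<open>g i\<close>; monotonicity of \<open>g\<close> makes
  \<open>R\<close> additive. If \<open>s / k\<close> is one of the quotients with supremum
  \<open>g i\<close>, then \<open>R k s\<close> holds, so a functional obeying \<open>R\<close> is
  at most \<open>1\<close> on every \<open>g i\<close> and therefore on \<open>z\<close>.\<close>

lemma way_below_le_SUP:
  fixes z :: 'a and g :: "nat \<Rightarrow> 'a functional \<Rightarrow> ennreal"
  assumes g: "incseq g" "\<And>i. g i \<in> realification"
    and z: "\<And>l. hat z l \<le> (SUP i. g i l)" and "z' \<lless> z" "1 < c"
  obtains i where "\<And>l. hat z' l \<le> ennreal c * g i l"
proof -
  define R :: "real \<Rightarrow> 'a \<Rightarrow> bool"
    where "R r x \<longleftrightarrow> (\<exists>i. \<forall>l. hat x l \<le> ennreal r * g i l)" for r x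
  have "\<exists>r. 0 < r \<and> r < c \<and> R r z'"
  proof (rule functional_separation[of R z z' c])
    show "R r 0" if "0 < r" for r
      unfolding R_def by (simp add: hat_def)
    show "R r x" if "x \<le> y" "R r y" for r x y
      using that unfolding R_def hat_def by (meson apply_functional_mono order_trans)
    show "R (r / real n) x" if n: "0 < n" "0 < r" and R: "R r (nmul n x)" for n r x
    proof -
      obtain i where i: "\<And>l. hat (nmul n x) l \<le> ennreal r * g i l"
        using R unfolding R_def by blast
      have "hat x l \<le> ennreal (r / real n) * g i l" for l
      proof -
        have "hat x l = ennreal (1 / real n) * hat (nmul n x) l"
          using n by (simp add: hat_def apply_functional_nmul ennreal_of_nat_eq_real_of_nat
              flip: mult.assoc ennreal_mult')
        also have "\<dots> \<le> ennreal (1 / real n) * (ennreal r * g i l)"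
          by (intro mult_left_mono i) auto
        also have "\<dots> = ennreal (r / real n) * g i l"
          using n by (simp flip: mult.assoc ennreal_mult')
        finally show ?thesis .
      qed
      then show ?thesis
        unfolding R_def by blast
    qed
    show "R (r + s) (x + y)" if R: "0 < r" "0 < s" "R r x" "R s y" for r s x y
    proof -
      obtain i j where ij: "\<And>l. hat x l \<le> ennreal r * g i l" "\<And>l. hat y l \<le> ennreal s * g j l"
        using R unfolding R_def by blast
      have "hat (x + y) l \<le> ennreal (r + s) * g (max i j) l" for l
      proof -
        have "g i l \<le> g (max i j) l" "g j l \<le> g (max i j) l"
          using g(1) by (auto simp: incseq_def le_fun_def)
        then have "hat x l + hat y l \<le> ennreal r * g (max i j) l + ennreal s * g (max i j) l"
          by (intro add_mono order_trans[OF ij(1)] order_trans[OF ij(2)] mult_left_mono) auto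
        then show ?thesis
          using that by (simp add: hat_def apply_functional_add ennreal_plus distrib_right)
      qed
      then show ?thesis
        unfolding R_def by blast
    qed
    show "apply_functional l z \<le> 1"
      if l: "\<And>r y. 0 < r \<Longrightarrow> R r y \<Longrightarrow> apply_functional l y \<le> ennreal r" for l
    proof -
      have "g i l \<le> 1" for i
      proof -
        obtain s :: "nat \<Rightarrow> 'a" and k :: "nat \<Rightarrow> nat" where k: "\<And>j. 0 < k j"
          and gi: "\<And>l. g i l = (SUP j. hat (s j) l / of_nat (k j))"
          using g(2)[of i] by (auto simp: realification_def)
        have "hat (s j) l / of_nat (k j) \<le> 1" for j
        proof -
          have "hat (s j) m \<le> ennreal (real (k j)) * g i m" for m
          proof -
            have "hat (s j) m / of_nat (k j) \<le> g i m"
              unfolding gi by (rule SUP_upper) simp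
            then show ?thesis
              using k[of j] mult_left_mono[of "hat (s j) m / of_nat (k j)" "g i m" "ennreal (real (k j))"]
              by (simp add: divide_of_nat_ennreal ennreal_mult_cancel_inverse)
          qed
          then have "R (real (k j)) (s j)"
            unfolding R_def by blast
          then have "apply_functional l (s j) \<le> ennreal (real (k j))"
            using l k[of j] by simp
          then show ?thesis
            using k[of j] by (simp add: hat_def divide_le_posI_ennreal ennreal_of_nat_eq_real_of_nat)
        qed
        then show ?thesis
          unfolding gi by (intro SUP_least)
      qed
      then have "(SUP i. g i l) \<le> 1"
        by (intro SUP_least)
      then show ?thesis
        using order_trans[OF z] by (simp add: hat_def)
    qed
  qed (use \<open>z' \<lless> z\<close> \<open>1 < c\<close> in auto)
  then obtain r i where "0 < r" "r < c" and i: "\<And>l. hat z' l \<le> ennreal r * g i l"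
    unfolding R_def by blast
  then have "hat z' l \<le> ennreal c * g i l" for l
    by (meson ennreal_leI less_imp_le mult_right_mono order_trans zero_le)
  then show ?thesis
    by (rule that)
qed

end

section \<open>The relation of being far below\<close>

lemma le_mult_one_interval_ennreal:
  fixes x y :: ennreal
  assumes "\<And>r. 0 < r \<Longrightarrow> r < 1 \<Longrightarrow> ennreal r * x \<le> y"
  shows "x \<le> y"
proof (cases x; cases y)
  fix a b assume ab: "x = ennreal a" "0 \<le> a" "y = ennreal b" "0 \<le> b"
  have "a \<le> b"
  proof (rule field_le_mult_one_interval)
    fix r :: real assume "0 < r" "r < 1"
    then show "r * a \<le> b"
      using assms[of r] ab by (simp flip: ennreal_mult')
  qed
  then show ?thesis
    using ab by (simp add: ennreal_leI)
qed (use assms[of "1 / 2"] in \<open>auto simp: ennreal_mult_top\<close>)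

lemma ennreal_inverse_mult_le_iff:
  "0 < k \<Longrightarrow> ennreal (1 / k) * x \<le> y \<longleftrightarrow> x \<le> ennreal k * y"
  using mult_left_mono[of "ennreal (1 / k) * x" y "ennreal k"]
    mult_left_mono[of x "ennreal k * y" "ennreal (1 / k)"]
    ennreal_mult_cancel_inverse[of k x] ennreal_mult_cancel_inverse[of "1 / k" y]
  by auto

text \<open>The sequence is chosen recursively: each new term dominates the previous one and the
  next element of an enumeration of \<open>Y\<close>.\<close>

lemma countable_directed_cofinal:
  fixes Y :: "'b::order set"
  assumes "countable Y" "Y \<noteq> {}" and dir: "\<And>a b. a \<in> Y \<Longrightarrow> b \<in> Y \<Longrightarrow> \<exists>c\<in>Y. a \<le> c \<and> b \<le> c"
  obtains c :: "nat \<Rightarrow> 'b" where "incseq c" "\<And>n. c n \<in> Y" "\<And>a. a \<in> Y \<Longrightarrow> \<exists>n. a \<le> c n"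
proof -
  have y: "from_nat_into Y n \<in> Y" for n
    using \<open>Y \<noteq> {}\<close> by (rule from_nat_into)
  have "\<exists>c. \<forall>n. (c n \<in> Y \<and> from_nat_into Y n \<le> c n) \<and> c n \<le> c (Suc n)"
  proof (rule dependent_nat_choice)
    show "\<exists>x. x \<in> Y \<and> from_nat_into Y 0 \<le> x"
      using y by blast
    fix x n assume "x \<in> Y \<and> from_nat_into Y n \<le> x"
    then show "\<exists>z. (z \<in> Y \<and> from_nat_into Y (Suc n) \<le> z) \<and> x \<le> z"
      using dir[of x "from_nat_into Y (Suc n)"] y by blast
  qed
  then obtain c where c: "\<And>n. c n \<in> Y" "\<And>n. from_nat_into Y n \<le> c n" "\<And>n. c n \<le> c (Suc n)"
    by blast
  show ?thesis
  proof (rule that[of c])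
    show "incseq c"
      using c(3) by (rule incseq_SucI)
    show "\<exists>n. a \<le> c n" if "a \<in> Y" for a
      using from_nat_into_surj[OF \<open>countable Y\<close> that] c(2) by metis
  qed (rule c(1))
qed

section \<open>Fractions and suprema of fractions\<close>

definition fraction :: "nat \<Rightarrow> 'a::ordered_semigroup \<Rightarrow> 'a functional \<Rightarrow> ennreal"
  where "fraction k s l = ennreal (1 / real k) * hat s l"

definition fractions :: "('a::ordered_semigroup functional \<Rightarrow> ennreal) set"
  where "fractions = {fraction k s |k s. 0 < k}"

lemma fraction_in_fractions: "0 < k \<Longrightarrow> fraction k s \<in> fractions"
  unfolding fractions_def by blast

lemma fraction_mono: "s \<le> t \<Longrightarrow> fraction k s l \<le> fraction k t l"
  unfolding fraction_def hat_def by (intro mult_left_mono apply_functional_mono) auto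

lemma fraction_add: "fraction k (s + t) l = fraction k s l + fraction k t l"
  by (simp add: fraction_def hat_def apply_functional_add distrib_left)

lemma fraction_nmul: "fraction (q * k) (nmul p s) l = ennreal (real p / real q) * fraction k s l"
  by (simp add: fraction_def hat_def apply_functional_nmul ennreal_of_nat_eq_real_of_nat
      mult.commute[of "real k"] flip: mult.assoc ennreal_mult')

lemma fraction_cancel: "0 < m \<Longrightarrow> fraction (m * k) (nmul m s) = fraction k s"
  by (rule ext) (simp add: fraction_nmul)

lemma fractions_common_denominator:
  assumes "e \<in> fractions" "f \<in> fractions"
  obtains k s t where "0 < k" "e = fraction k s" "f = fraction k t"
proof -
  obtain m n s t where "0 < m" "e = fraction m s" "0 < n" "f = fraction n t"
    using assms unfolding fractions_def by blast
  then show ?thesis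
    using that[of "n * m" "nmul n s" "nmul m t"] fraction_cancel[of n m s] fraction_cancel[of m n t]
    by (simp add: mult.commute)
qed

lemma fractions_add:
  assumes "e \<in> fractions" "f \<in> fractions"
  shows "(\<lambda>l. e l + f l) \<in> fractions"
proof -
  obtain k s t where "0 < k" "e = fraction k s" "f = fraction k t"
    using fractions_common_denominator[OF assms] by metis
  then have "(\<lambda>l. e l + f l) = fraction k (s + t)"
    by (auto simp: fraction_add)
  with \<open>0 < k\<close> show ?thesis
    by (simp add: fraction_in_fractions)
qed

text \<open>Multiplying \<open>s / k\<close> by \<open>p / q\<close> gives
  \<open>(p s) / (q k)\<close>. This is why constants chosen later come with membership in
  \<open>\<rat>\<close>.\<close>

lemma fractions_scale:
  assumes "e \<in> fractions" "r \<in> \<rat>" "0 \<le> r"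
  shows "(\<lambda>l. ennreal r * e l) \<in> fractions"
proof -
  obtain k s where e: "0 < k" "e = fraction k s"
    using assms(1) unfolding fractions_def by blast
  obtain p q :: nat where "q \<noteq> 0" "\<bar>r\<bar> = real p / real q"
    using Rats_abs_nat_div_natE[OF assms(2)] by metis
  then have "(\<lambda>l. ennreal r * e l) = fraction (q * k) (nmul p s)"
    using assms(3) by (auto simp: e fraction_nmul)
  with \<open>q \<noteq> 0\<close> e(1) show ?thesis
    by (simp add: fraction_in_fractions)
qed

text \<open>Membership in \<open>Lsc_functional\<close> is formal except for openness: the strict
  superlevel set of a supremum is the union of those of the fractions, which are open by the lower
  half of \<open>functional_lim\<close>.\<close>

lemma SUP_fractions_in_realification:
  fixes e :: "nat \<Rightarrow> 'a::ordered_semigroup functional \<Rightarrow> ennreal"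
  assumes "incseq e" "\<And>i. e i \<in> fractions" and f: "\<And>l. f l = (SUP i. e i l)"
  shows "f \<in> realification"
proof -
  have "\<forall>i. \<exists>k s. 0 < k \<and> e i = fraction k s"
    using assms(2) unfolding fractions_def by blast
  then obtain k s where k: "\<And>i. 0 < k i" and e: "\<And>i. e i = fraction (k i) (s i)"
    by metis
  have e': "e i l = hat (s i) l / of_nat (k i)" for i l
    using k[of i] by (simp add: e fraction_def divide_of_nat_ennreal)
  have e_add: "e i (l + m) = e i l + e i m" for i l m
    by (simp add: e fraction_def hat_def plus_functional.rep_eq distrib_left)
  have e_scale: "e i (scale_functional c l) = ennreal c * e i l" for i c l
    by (simp add: e fraction_def hat_def scale_functional.rep_eq mult.left_commute)
  have "open {l. r < f l}" for r
  proof -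
    have "{l. r < f l} = (\<Union>i. {l. r < e i l})"
      by (auto simp: f less_SUP_iff)
    moreover have "open {l. r < e i l}" for i
      unfolding open_functional_def
    proof (intro ballI allI impI)
      fix l :: "'a functional" and F assume l: "l \<in> {l. r < e i l}" and F: "functional_lim (\<lambda>m. m) l F"
      have c: "r < ennreal (1 / real (k i)) * x \<longleftrightarrow> ennreal (real (k i)) * r < x" for x
        using ennreal_inverse_mult_le_iff[of "real (k i)" x r] k[of i] by (metis not_le of_nat_0_less_iff)
      show "\<forall>\<^sub>F m in F. m \<in> {l. r < e i l}"
        \<comment> \<open>\<open>functional_lim_iff\<close> speaks about \<open>s i\<close> only in
          the presence of an element way below it; \<open>0\<close> serves.\<close>
        using l F zero_way_below[of "s i"] unfolding functional_lim_iff
        by (auto simp: e fraction_def hat_def c)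
    qed
    ultimately show ?thesis
      by (simp add: open_UN)
  qed
  moreover have "f (l + m) = f l + f m" for l m
    using assms(1) unfolding f e_add
    by (intro ennreal_SUP_add[symmetric, THEN sym]) (auto simp: incseq_def le_fun_def)
  moreover have "f (scale_functional c l) = ennreal c * f l" for c l
    by (simp add: f e_scale SUP_mult_left_ennreal)
  moreover have "f 0 = 0"
    by (simp add: f e fraction_def hat_def zero_functional.rep_eq)
  ultimately have "f \<in> Lsc_functional"
    by (simp add: Lsc_functional_def)
  moreover have "incseq (\<lambda>i l. hat (s i) l / of_nat (k i))"
    using assms(1) by (simp add: e'[symmetric])
  ultimately show ?thesis
    unfolding realification_def using k e' f by auto
qed

lemma realification_fractionsE:
  fixes f :: "'a::ordered_semigroup functional \<Rightarrow> ennreal"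
  assumes "f \<in> realification"
  obtains e where "incseq e" "\<And>i. e i \<in> fractions" "\<And>l. f l = (SUP i::nat. e i l)" "\<And>i. e i \<le> f"
proof -
  obtain s :: "nat \<Rightarrow> 'a" and k :: "nat \<Rightarrow> nat" where k: "\<And>j. 0 < k j"
    and inc: "incseq (\<lambda>i l. hat (s i) l / of_nat (k i))"
    and f: "\<And>l. f l = (SUP j. hat (s j) l / of_nat (k j))"
    using assms by (auto simp: realification_def)
  have eq: "fraction (k i) (s i) l = hat (s i) l / of_nat (k i)" for i l
    using k by (simp add: fraction_def divide_of_nat_ennreal)
  show ?thesis
  proof (rule that[of "\<lambda>i. fraction (k i) (s i)"])
    show "incseq (\<lambda>i. fraction (k i) (s i))"
      using inc by (simp add: incseq_def le_fun_def eq)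
    show fSUP: "f l = (SUP i. fraction (k i) (s i) l)" for l
      by (simp add: f eq)
    show "fraction (k i) (s i) \<le> f" for i
      unfolding le_fun_def fSUP by (auto intro: SUP_upper)
  qed (simp add: fraction_in_fractions k)
qed

lemma fractions_subset_realification: "e \<in> fractions \<Longrightarrow> e \<in> realification"
  by (rule SUP_fractions_in_realification[of "\<lambda>_. e"]) (auto simp: incseq_def)

lemma realification_add:
  assumes "f \<in> realification" "g \<in> realification"
  shows "(\<lambda>l. f l + g l) \<in> realification"
proof -
  obtain a where a: "incseq a" "\<And>i. a i \<in> fractions" "\<And>l. f l = (SUP i::nat. a i l)"
    using realification_fractionsE[OF assms(1)] by metis
  obtain b where b: "incseq b" "\<And>i. b i \<in> fractions" "\<And>l. g l = (SUP i::nat. b i l)"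
    using realification_fractionsE[OF assms(2)] by metis
  show ?thesis
  proof (rule SUP_fractions_in_realification)
    show "incseq (\<lambda>i l. a i l + b i l)"
      using a(1) b(1) by (auto simp: incseq_def le_fun_def intro: add_mono)
    show "f l + g l = (SUP i. a i l + b i l)" for l
      unfolding a(3) b(3) using a(1) b(1)
      by (intro ennreal_SUP_add[symmetric]) (auto simp: incseq_def le_fun_def)
  qed (intro fractions_add a(2) b(2))
qed

lemma realification_scale:
  assumes "f \<in> realification" "r \<in> \<rat>" "0 \<le> r"
  shows "(\<lambda>l. ennreal r * f l) \<in> realification"
proof -
  obtain a where a: "incseq a" "\<And>i. a i \<in> fractions" "\<And>l. f l = (SUP i::nat. a i l)"
    using realification_fractionsE[OF assms(1)] by metis
  show ?thesis
  proof (rule SUP_fractions_in_realification)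
    show "incseq (\<lambda>i l. ennreal r * a i l)"
      using a(1) by (auto simp: incseq_def le_fun_def intro: mult_left_mono)
    show "ennreal r * f l = (SUP i. ennreal r * a i l)" for l
      by (simp add: a(3) SUP_mult_left_ennreal)
  qed (intro fractions_scale a(2) assms)
qed

text \<open>A concrete way-below relation between functions, made for the compactness in
  \<open>far_below_SUP\<close>. The gap \<open>s' \<lless> s\<close> pays for regularisation and the
  gap \<open>r < 1\<close> for the factor \<open>c > 1\<close> in
  \<open>way_below_le_SUP\<close>.\<close>

definition far_below ::
  "('a::ordered_semigroup functional \<Rightarrow> ennreal) \<Rightarrow> ('a functional \<Rightarrow> ennreal) \<Rightarrow> bool"
    (infix \<open>\<lless>\<^sub>R\<close> 50)
  where "a \<lless>\<^sub>R b \<longleftrightarrow> (\<exists>k s' s r. 0 < k \<and> s' \<lless> s \<and> 0 < r \<and> r < 1 \<and>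
    (\<forall>l. a l \<le> ennreal r * fraction k s' l) \<and> fraction k s \<le> b)"

lemma far_below_mono: "a \<le> a' \<Longrightarrow> a' \<lless>\<^sub>R b' \<Longrightarrow> b' \<le> b \<Longrightarrow> a \<lless>\<^sub>R b"
  unfolding far_below_def by (meson le_funD order_trans)

lemma far_below_imp_le:
  assumes "a \<lless>\<^sub>R b"
  shows "a \<le> b"
proof (rule le_funI)
  fix l
  obtain k s' s r where *: "s' \<lless> s" "0 < r" "r < 1" "a l \<le> ennreal r * fraction k s' l" "fraction k s \<le> b"
    using assms unfolding far_below_def by blast
  note *(4)
  also have "ennreal r * fraction k s' l \<le> 1 * fraction k s' l"
    using *(2,3) by (intro mult_right_mono) auto
  also have "\<dots> \<le> fraction k s l"
    using fraction_mono[OF way_below_imp_le[OF *(1)]] by simp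
  also have "\<dots> \<le> b l"
    using *(5) by (rule le_funD)
  finally show "a l \<le> b l" .
qed

lemma zero_far_below: "(\<lambda>_. 0) \<lless>\<^sub>R b"
  unfolding far_below_def
  by (intro exI[of _ 1] exI[of _ 0] exI[of _ "1 / 2"])
     (simp add: zero_way_below le_fun_def fraction_def hat_def)

text \<open>The factor may be raised to a rational below \<open>1\<close>, which can then be
  expressed by multiples of elements.\<close>

lemma far_belowE_rat:
  assumes "a \<lless>\<^sub>R b"
  obtains k s' s p q where "0 < k" "s' \<lless> s" "0 < p" "p < q"
    "\<And>l. a l \<le> ennreal (real p / real q) * fraction k s' l" "fraction k s \<le> b"
proof -
  obtain k s' s r where *: "0 < k" "s' \<lless> s" "0 < r" "r < 1" "\<And>l. a l \<le> ennreal r * fraction k s' l"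
    "fraction k s \<le> b"
    using assms unfolding far_below_def by blast
  obtain x where x: "x \<in> \<rat>" "r < x" "x < 1"
    using Rats_dense_in_real[OF \<open>r < 1\<close>] by blast
  obtain p q :: nat where pq: "q \<noteq> 0" "\<bar>x\<bar> = real p / real q"
    using Rats_abs_nat_div_natE[OF x(1)] by metis
  have "0 < x"
    using x(2) *(3) by simp
  then have xpq: "x = real p / real q"
    using pq by simp
  then have "real p = x * real q"
    using pq(1) by simp
  then have "0 < real p" "real p < real q"
    using pq(1) x(3) \<open>0 < x\<close> by simp_all
  then have "0 < p" "p < q"
    by simp_all
  moreover have "a l \<le> ennreal (real p / real q) * fraction k s' l" for l
    using *(5) x(2) unfolding xpq[symmetric]
    by (meson ennreal_leI less_imp_le mult_right_mono order_trans zero_le)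
  ultimately show ?thesis
    using that *(1,2,6) by blast
qed

lemma far_below_scaleI:
  assumes "s' \<lless> s" "0 < p" "p < q" "0 < k"
    "\<And>l. a l \<le> ennreal (real p / real q) * fraction k s' l" "fraction k s \<le> b"
  shows "a \<lless>\<^sub>R b"
  unfolding far_below_def using assms
  by (intro exI[of _ k] exI[of _ s'] exI[of _ s] exI[of _ "real p / real q"]) auto

text \<open>Since \<open>r < 1\<close>, some \<open>d > 0\<close> satisfies
  \<open>(1 + d) * r < 1\<close>. The spare factor \<open>1 + d\<close> later pays for the errors of
  approximate complements.\<close>

lemma far_below_slack:
  assumes "a \<lless>\<^sub>R b"
  obtains d where "0 < d" "d < 1" "d \<in> \<rat>" "(\<lambda>l. ennreal (1 + d) * a l) \<lless>\<^sub>R b"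
proof -
  obtain k s' s r where *: "0 < k" "s' \<lless> s" "0 < r" "r < 1" "\<And>l. a l \<le> ennreal r * fraction k s' l"
    "fraction k s \<le> b"
    using assms unfolding far_below_def by blast
  obtain d where d: "d \<in> \<rat>" "0 < d" "d < min 1 (1 / r - 1)"
    using Rats_dense_in_real[of 0 "min 1 (1 / r - 1)"] *(3,4) by auto
  have "(1 + d) * r < 1"
    using d(3) *(3) by (simp add: field_simps)
  moreover have "ennreal (1 + d) * a l \<le> ennreal ((1 + d) * r) * fraction k s' l" for l
    using mult_left_mono[OF *(5), of "ennreal (1 + d)"] d(2) by (simp add: ennreal_mult' mult.assoc)
  ultimately have "(\<lambda>l. ennreal (1 + d) * a l) \<lless>\<^sub>R b"
    unfolding far_below_def using * d(2)
    by (intro exI[of _ k] exI[of _ s'] exI[of _ s] exI[of _ "(1 + d) * r"]) auto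
  with d show ?thesis
    using that by auto
qed

text \<open>Over the denominator \<open>m * k\<close> the way-below pairs add by O3, and the larger
  of the two factors serves for the sum.\<close>

lemma far_below_add:
  assumes "a \<lless>\<^sub>R b" "a' \<lless>\<^sub>R b'" and O3: "axiom_O3 TYPE('a::ordered_semigroup)"
  shows "(\<lambda>l::'a functional. a l + a' l) \<lless>\<^sub>R (\<lambda>l. b l + b' l)"
proof -
  obtain k s' s r where *: "0 < k" "s' \<lless> s" "0 < r" "r < 1" "\<And>l. a l \<le> ennreal r * fraction k s' l"
    "fraction k s \<le> b"
    using assms(1) unfolding far_below_def by blast
  obtain m t' t q where **: "0 < m" "t' \<lless> t" "0 < q" "q < 1" "\<And>l. a' l \<le> ennreal q * fraction m t' l"
    "fraction m t \<le> b'"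
    using assms(2) unfolding far_below_def by blast
  have wb: "nmul n x \<lless> nmul n y" if "x \<lless> y" for n and x y :: 'a
    using that O3 unfolding axiom_O3_def by (induction n) (auto simp: nmul_Suc zero_way_below)
  have "nmul m s' + nmul k t' \<lless> nmul m s + nmul k t"
    using O3 wb *(2) **(2) unfolding axiom_O3_def by blast
  moreover have "a l + a' l \<le> ennreal (max r q) * fraction (m * k) (nmul m s' + nmul k t') l" for l
  proof -
    have "a l + a' l \<le> ennreal (max r q) * fraction k s' l + ennreal (max r q) * fraction m t' l"
      by (intro add_mono order_trans[OF *(5)] order_trans[OF **(5)] mult_right_mono ennreal_leI) auto
    also have "\<dots> = ennreal (max r q) * fraction (m * k) (nmul m s' + nmul k t') l"
      using fraction_cancel[of m k s'] fraction_cancel[of k m t'] *(1) **(1)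
      by (simp add: fraction_add distrib_left mult.commute)
    finally show ?thesis .
  qed
  moreover have "fraction (m * k) (nmul m s + nmul k t) l \<le> b l + b' l" for l
    using fraction_cancel[of m k s] fraction_cancel[of k m t] *(1,6) **(1,6)
    by (simp add: fraction_add mult.commute le_fun_def add_mono)
  ultimately show ?thesis
    unfolding far_below_def le_fun_def using * **
    by (intro exI[of _ "m * k"] exI[of _ "nmul m s' + nmul k t'"] exI[of _ "nmul m s + nmul k t"]
        exI[of _ "max r q"]) auto
qed

section \<open>Interpolation, compactness and directed suprema\<close>

context cu_semigroup
begin

text \<open>Both gaps are divided: \<open>s''\<close> lies between \<open>s'\<close> and
  \<open>s\<close>, the rational \<open>x\<close> between \<open>r\<close> and \<open>1\<close>, and
  \<open>e\<close> is \<open>x\<close> times \<open>s'' / k\<close>. The factor left for the lower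
  half is \<open>r / x\<close>.\<close>

lemma far_below_interpolate:
  fixes a b :: "'a functional \<Rightarrow> ennreal"
  assumes "a \<lless>\<^sub>R b"
  obtains e where "e \<in> fractions" "a \<lless>\<^sub>R e" "e \<lless>\<^sub>R b"
proof -
  obtain k s' s r where *: "0 < k" "s' \<lless> s" "0 < r" "r < 1" "\<And>l. a l \<le> ennreal r * fraction k s' l"
    "fraction k s \<le> b"
    using assms unfolding far_below_def by blast
  obtain x where x: "x \<in> \<rat>" "r < x" "x < 1"
    using Rats_dense_in_real[OF \<open>r < 1\<close>] by blast
  obtain p q :: nat where pq: "q \<noteq> 0" "\<bar>x\<bar> = real p / real q"
    using Rats_abs_nat_div_natE[OF x(1)] by metis
  have "0 < x"
    using x(2) *(3) by simp
  then have xpq: "x = real p / real q"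
    using pq by simp
  have "0 < p"
    using \<open>0 < x\<close> xpq by (cases p) auto
  obtain s'' where s'': "s' \<lless> s''" "s'' \<lless> s"
    using way_below_interpolate[OF O2 *(2)] .
  define e where "e = fraction (q * k) (nmul p s'')"
  have "a l \<le> ennreal (r / x) * fraction (q * k) (nmul p s') l" for l
    using *(5)[of l] \<open>0 < x\<close> \<open>0 < r\<close>
    by (simp add: fraction_nmul xpq[symmetric] flip: mult.assoc ennreal_mult')
  then have "a \<lless>\<^sub>R e"
    unfolding far_below_def e_def using way_below_nmul[OF s''(1), of p] x(2) * pq(1) \<open>0 < x\<close>
    by (intro exI[of _ "q * k"] exI[of _ "nmul p s'"] exI[of _ "nmul p s''"] exI[of _ "r / x"]) auto
  moreover have "e \<lless>\<^sub>R b"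
    unfolding far_below_def e_def using s''(2) x *(1,3,6) \<open>0 < x\<close>
    by (intro exI[of _ k] exI[of _ s''] exI[of _ s] exI[of _ x]) (auto simp: fraction_nmul xpq[symmetric])
  moreover have "e \<in> fractions"
    unfolding e_def using pq(1) *(1) by (intro fraction_in_fractions) simp
  ultimately show ?thesis
    using that by blast
qed

lemma fractions_approx:
  fixes e :: "'a functional \<Rightarrow> ennreal"
  assumes "e \<in> fractions"
  obtains c where "incseq c" "\<And>i::nat. c i \<in> fractions" "\<And>i. c i \<lless>\<^sub>R e" "\<And>l. e l = (SUP i. c i l)"
proof -
  obtain k s where e: "0 < k" "e = fraction k s"
    using assms unfolding fractions_def by blast
  obtain T where T: "isLub UNIV (range T) s" "incseq T" "\<And>n. T n \<lless> s"
    using approx_seq[of s] by metis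
  \<comment> \<open>The shift by \<open>2\<close> keeps the factor strictly between \<open>0\<close>
    and \<open>1\<close> already at \<open>n = 0\<close>.\<close>
  define r :: "nat \<Rightarrow> real" where "r n = 1 - 1 / real (n + 2)" for n
  define c where "c n l = ennreal (r n) * fraction k (T n) l" for n l
  have r: "0 < r n" "r n < 1" "r n \<in> \<rat>" for n
    by (auto simp: r_def)
  have "incseq r"
    by (auto simp: incseq_def r_def frac_le)
  then have "incseq c"
    using T(2) by (auto simp: incseq_def le_fun_def c_def intro!: mult_mono ennreal_leI fraction_mono)
  moreover have "c n \<in> fractions" for n
    unfolding c_def[abs_def] using e(1) r[of n] by (intro fractions_scale fraction_in_fractions) auto
  moreover have "c n \<lless>\<^sub>R e" for n
    unfolding far_below_def e(2) using e(1) r[of n] T(3)[of n]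
    by (intro exI[of _ k] exI[of _ "T n"] exI[of _ s] exI[of _ "r n"]) (auto simp: c_def)
  moreover have "e l = (SUP i. c i l)" for l
  proof (rule antisym)
    have el: "e l = (SUP m. fraction k (T m) l)"
      unfolding e(2) fraction_def hat_def apply_functional_SUP[OF T(2,1)] SUP_mult_left_ennreal ..
    show "e l \<le> (SUP i. c i l)"
    proof (rule le_mult_one_interval_ennreal)
      fix x :: real assume "0 < x" "x < 1"
      obtain n where n: "1 / real (Suc n) < 1 - x"
        using reals_Archimedean[of "1 - x"] \<open>x < 1\<close> by (auto simp: inverse_eq_divide)
      have "ennreal x * fraction k (T m) l \<le> (SUP i. c i l)" for m
      proof -
        have "1 / real (max m n + 2) \<le> 1 / real (Suc n)"
          by (intro frac_le) auto
        then have "x \<le> r (max m n)"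
          using n unfolding r_def by linarith
        then have "ennreal x * fraction k (T m) l \<le> c (max m n) l"
          unfolding c_def using T(2) by (intro mult_mono ennreal_leI fraction_mono) (auto simp: incseq_def)
        also have "\<dots> \<le> (SUP i. c i l)"
          by (rule SUP_upper) simp
        finally show ?thesis .
      qed
      then show "ennreal x * e l \<le> (SUP i. c i l)"
        unfolding el SUP_mult_left_ennreal by (intro SUP_least)
    qed
    show "(SUP i. c i l) \<le> e l"
      using far_below_imp_le[OF \<open>\<And>n. c n \<lless>\<^sub>R e\<close>] by (intro SUP_least) (auto simp: le_fun_def)
  qed
  ultimately show ?thesis
    using that by blast
qed

text \<open>\<open>way_below_le_SUP\<close> is applied to \<open>k\<close> times \<open>g\<close>
  with \<open>c = 1 / r\<close>; the loss of \<open>1 / r\<close> cancels the factor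
  \<open>r\<close> in the definition. This gives only \<open>e \<le> g i\<close>, and interpolating
  \<open>e\<close> first upgrades it to the strict relation for \<open>a\<close>.\<close>

lemma far_below_SUP:
  fixes g :: "nat \<Rightarrow> 'a functional \<Rightarrow> ennreal"
  assumes "a \<lless>\<^sub>R b" and g: "incseq g" "\<And>i. g i \<in> realification" and b: "\<And>l. b l \<le> (SUP i. g i l)"
  obtains i where "a \<lless>\<^sub>R g i"
proof -
  obtain e where e: "a \<lless>\<^sub>R e" "e \<lless>\<^sub>R b"
    using far_below_interpolate[OF assms(1)] by metis
  obtain k s' s r where *: "0 < k" "s' \<lless> s" "0 < r" "r < 1" "\<And>l. e l \<le> ennreal r * fraction k s' l"
    "fraction k s \<le> b"
    using e(2) unfolding far_below_def by blast
  define h where "h i l = ennreal (real k) * g i l" for i l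
  have "incseq h"
    using g(1) by (auto simp: h_def incseq_def le_fun_def intro: mult_left_mono)
  moreover have "h i \<in> realification" for i
    unfolding h_def[abs_def] by (intro realification_scale g(2)) auto
  moreover have "hat s l \<le> (SUP i. h i l)" for l
  proof -
    have "hat s l = ennreal (real k) * fraction k s l"
      using *(1) by (simp add: fraction_def ennreal_mult_cancel_inverse)
    also have "\<dots> \<le> ennreal (real k) * (SUP i. g i l)"
      using *(6) b by (intro mult_left_mono) (auto simp: le_fun_def intro: order_trans)
    finally show ?thesis
      by (simp add: h_def SUP_mult_left_ennreal)
  qed
  moreover have "1 < 1 / r"
    using *(3,4) by simp
  ultimately obtain i where i: "\<And>l. hat s' l \<le> ennreal (1 / r) * h i l"
    using way_below_le_SUP[of h s s' "1 / r"] *(2) by metis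
  have "e l \<le> g i l" for l
  proof -
    have "e l \<le> ennreal r * (ennreal (1 / real k) * (ennreal (1 / r) * h i l))"
      using *(5)[of l] i[of l] unfolding fraction_def by (meson mult_left_mono order_trans zero_le)
    also have "\<dots> = g i l"
      using *(1,3) by (simp add: h_def flip: mult.assoc ennreal_mult')
    finally show ?thesis .
  qed
  then have "a \<lless>\<^sub>R g i"
    using e(1) far_below_mono[of a a e "g i"] by (auto simp: le_fun_def)
  then show ?thesis
    by (rule that)
qed

text \<open>Compactness is used twice: along fractions increasing to \<open>z\<close>, and then
  along approximants of the fraction found, so that the common bound is itself far below
  \<open>z\<close>.\<close>

lemma far_below_common:
  fixes z :: "'a functional \<Rightarrow> ennreal"
  assumes "a \<lless>\<^sub>R z" "b \<lless>\<^sub>R z" "z \<in> realification"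
  obtains c where "c \<in> fractions" "a \<lless>\<^sub>R c" "b \<lless>\<^sub>R c" "c \<lless>\<^sub>R z"
proof -
  have inc: "\<exists>n. a \<lless>\<^sub>R c n \<and> b \<lless>\<^sub>R c n"
    if c: "incseq c" "\<And>i::nat. c i \<in> fractions" "\<And>l. w l = (SUP i. c i l)"
      and w: "a \<lless>\<^sub>R w" "b \<lless>\<^sub>R w" for c w
  proof -
    obtain i where i: "a \<lless>\<^sub>R c i"
      using far_below_SUP[OF w(1) c(1) fractions_subset_realification[OF c(2)]] c(3) by (metis order_refl)
    obtain j where j: "b \<lless>\<^sub>R c j"
      using far_below_SUP[OF w(2) c(1) fractions_subset_realification[OF c(2)]] c(3) by (metis order_refl)
    have "c i \<le> c (max i j)" "c j \<le> c (max i j)"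
      using c(1) by (auto simp: incseq_def)
    with i j show ?thesis
      using far_below_mono by blast
  qed
  obtain e where e: "incseq e" "\<And>i. e i \<in> fractions" "\<And>l. z l = (SUP i::nat. e i l)" "\<And>i. e i \<le> z"
    using realification_fractionsE[OF assms(3)] by metis
  obtain n where n: "a \<lless>\<^sub>R e n" "b \<lless>\<^sub>R e n"
    using inc[OF e(1-3) assms(1,2)] by blast
  obtain c where c: "incseq c" "\<And>i::nat. c i \<in> fractions" "\<And>i. c i \<lless>\<^sub>R e n" "\<And>l. e n l = (SUP i. c i l)"
    using fractions_approx[OF e(2)] by metis
  obtain m where "a \<lless>\<^sub>R c m" "b \<lless>\<^sub>R c m"
    using inc[OF c(1,2,4) n] by blast
  moreover have "c m \<lless>\<^sub>R z"
    using c(3) e(4) far_below_mono by blast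
  ultimately show ?thesis
    using that c(2) by blast
qed

text \<open>An element is the pointwise supremum of the fractions far below it, so an upper bound
  need only be tested on these.\<close>

lemma realification_leI:
  fixes f :: "'a functional \<Rightarrow> ennreal"
  assumes "f \<in> realification" "\<And>a. a \<in> fractions \<Longrightarrow> a \<lless>\<^sub>R f \<Longrightarrow> a l \<le> B"
  shows "f l \<le> B"
proof -
  obtain e where e: "\<And>i. e i \<in> fractions" "\<And>l. f l = (SUP i::nat. e i l)" "\<And>i. e i \<le> f"
    using realification_fractionsE[OF assms(1)] by metis
  have "e i l \<le> B" for i
  proof -
    obtain c where c: "\<And>j::nat. c j \<in> fractions" "\<And>j. c j \<lless>\<^sub>R e i" "\<And>l. e i l = (SUP j. c j l)"
      using fractions_approx[OF e(1)] by metis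
    have "c j l \<le> B" for j
      using assms(2) c(1,2) e(3) far_below_mono by blast
    then show ?thesis
      unfolding c(3) by (intro SUP_least)
  qed
  then show ?thesis
    unfolding e(2) by (intro SUP_least)
qed

text \<open>The analogue of \<open>way_below_add_split\<close>, with compactness along the sums of
  approximants.\<close>

lemma far_below_add_split:
  fixes x y :: "'a functional \<Rightarrow> ennreal"
  assumes "a \<lless>\<^sub>R b" "x \<in> fractions" "y \<in> fractions" "\<And>l. b l \<le> x l + y l"
  obtains x' y' where "x' \<in> fractions" "y' \<in> fractions" "x' \<lless>\<^sub>R x" "y' \<lless>\<^sub>R y"
    "\<And>l. a l \<le> x' l + y' l"
proof -
  obtain c where c: "incseq c" "\<And>i::nat. c i \<in> fractions" "\<And>i. c i \<lless>\<^sub>R x" "\<And>l. x l = (SUP i. c i l)"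
    using fractions_approx[OF assms(2)] by metis
  obtain d where d: "incseq d" "\<And>i::nat. d i \<in> fractions" "\<And>i. d i \<lless>\<^sub>R y" "\<And>l. y l = (SUP i. d i l)"
    using fractions_approx[OF assms(3)] by metis
  have inc: "incseq (\<lambda>i l. c i l + d i l)"
    using c(1) d(1) by (auto simp: incseq_def le_fun_def intro: add_mono)
  have real: "(\<lambda>l. c i l + d i l) \<in> realification" for i
    by (intro fractions_subset_realification fractions_add c(2) d(2))
  have le: "b l \<le> (SUP i. c i l + d i l)" for l
    using assms(4)[of l] c(1) d(1) unfolding c(4) d(4)
    by (subst ennreal_SUP_add) (auto simp: incseq_def le_fun_def)
  obtain i where "a \<lless>\<^sub>R (\<lambda>l. c i l + d i l)"
    by (rule far_below_SUP[OF assms(1) inc real le])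
  then have "a l \<le> c i l + d i l" for l
    using far_below_imp_le by (auto simp: le_fun_def)
  then show ?thesis
    using that c(2,3) d(2,3) by blast
qed

text \<open>Fractions with numerators that are multiples of elements of \<open>D\<close> form a
  countable set \<open>C\<close> which interpolates the far-below relation. Those far below some
  member of \<open>X\<close> are directed, and a cofinal sequence among them has the same supremum
  as \<open>X\<close>.\<close>

lemma directed_SUP_in_realification:
  fixes X :: "('a functional \<Rightarrow> ennreal) set"
  assumes D: "countable D" "dense_subset (D :: 'a set)"
    and X: "X \<subseteq> realification" "X \<noteq> {}"
    and dir: "\<And>x y a b. x \<in> X \<Longrightarrow> y \<in> X \<Longrightarrow> a \<in> fractions \<Longrightarrow> b \<in> fractions \<Longrightarrow>
      a \<lless>\<^sub>R x \<Longrightarrow> b \<lless>\<^sub>R y \<Longrightarrow> \<exists>z\<in>X. a \<lless>\<^sub>R z \<and> b \<lless>\<^sub>R z"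
  shows "(\<lambda>l. SUP f\<in>X. f l) \<in> realification"
proof -
  define C where "C = (\<lambda>(k, p, s). fraction (Suc k) (nmul p s)) ` (UNIV \<times> UNIV \<times> D)"
  have C: "countable C" "C \<subseteq> fractions"
    unfolding C_def using D(1)
    by (auto intro!: countable_image countable_SIGMA fraction_in_fractions)
  have C_dense: "\<exists>c\<in>C. a \<le> c \<and> c \<lless>\<^sub>R b" if ab: "a \<lless>\<^sub>R b" for a b
  proof -
    obtain k s' s p q where *: "0 < k" "s' \<lless> s" "0 < p" "p < q"
      "\<And>l. a l \<le> ennreal (real p / real q) * fraction k s' l" "fraction k s \<le> b"
      using far_belowE_rat[OF ab] by metis
    obtain T where T: "range T \<subseteq> D" "\<And>n. T n \<lless> T (Suc n)" "isLub UNIV (range T) s"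
      using D(2) unfolding dense_subset_def by metis
    have "incseq T"
      by (rule incseq_SucI) (rule way_below_imp_le[OF T(2)])
    then obtain n where n: "s' \<le> T n"
      using *(2) T(3) unfolding way_below_def by blast
    have "T n \<lless> s"
      using way_below_mono[OF order_refl T(2)] isLubD2[OF T(3)] by blast
    then have "fraction (q * k) (nmul p (T n)) \<lless>\<^sub>R b"
      using * by (intro far_below_scaleI[of "T n" s p q k]) (auto simp: fraction_nmul)
    moreover have "a \<le> fraction (q * k) (nmul p (T n))"
      unfolding le_fun_def fraction_nmul using *(5) fraction_mono[OF n]
      by (meson mult_left_mono order_trans zero_le)
    moreover have "fraction (q * k) (nmul p (T n)) \<in> C"
      \<comment> \<open>\<open>C\<close> indexes denominators by their predecessor to keep them
        positive, hence \<open>q * k - 1\<close>.\<close>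
      unfolding C_def using T(1) *(1,4)
      by (intro image_eqI[of _ _ "(q * k - 1, p, T n)"]) auto
    ultimately show ?thesis by blast
  qed
  define Y where "Y = {c \<in> C. \<exists>x\<in>X. c \<lless>\<^sub>R x}"
  have "countable Y"
    unfolding Y_def using C(1) by (rule countable_subset[rotated]) auto
  moreover have "Y \<noteq> {}"
    using X(2) C_dense[OF zero_far_below] unfolding Y_def by blast
  moreover have "\<exists>c\<in>Y. a \<le> c \<and> b \<le> c" if "a \<in> Y" "b \<in> Y" for a b
  proof -
    obtain z where z: "z \<in> X" "a \<lless>\<^sub>R z" "b \<lless>\<^sub>R z"
      using dir \<open>a \<in> Y\<close> \<open>b \<in> Y\<close> C(2) unfolding Y_def by blast
    obtain c where "a \<lless>\<^sub>R c" "b \<lless>\<^sub>R c" "c \<lless>\<^sub>R z"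
      using far_below_common[OF z(2,3)] X(1) z(1) by blast
    moreover obtain d where "d \<in> C" "c \<le> d" "d \<lless>\<^sub>R z"
      using C_dense[OF \<open>c \<lless>\<^sub>R z\<close>] by blast
    moreover have "d \<in> Y"
      using \<open>d \<in> C\<close> \<open>d \<lless>\<^sub>R z\<close> z(1) unfolding Y_def by blast
    ultimately show ?thesis
      using far_below_imp_le[of a c] far_below_imp_le[of b c] by (meson order_trans)
  qed
  ultimately obtain c where c: "incseq c" "\<And>n::nat. c n \<in> Y" "\<And>a. a \<in> Y \<Longrightarrow> \<exists>n. a \<le> c n"
    by (rule countable_directed_cofinal) blast+
  show ?thesis
  proof (rule SUP_fractions_in_realification[OF c(1)])
    show "c i \<in> fractions" for i
      using c(2) C(2) unfolding Y_def by blast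
    show "(SUP f\<in>X. f l) = (SUP i. c i l)" for l
    proof (intro antisym SUP_least)
      fix x assume x: "x \<in> X"
      show "x l \<le> (SUP i. c i l)"
      proof (rule realification_leI)
        show "x \<in> realification"
          using x X(1) by blast
        fix a assume "a \<lless>\<^sub>R x"
        then obtain d where d: "d \<in> C" "a \<le> d" "d \<lless>\<^sub>R x"
          using C_dense by blast
        then have "d \<in> Y"
          using x unfolding Y_def by blast
        then obtain n where "d \<le> c n"
          using c(3) by blast
        then have "a l \<le> c n l"
          using d(2) by (meson le_funD order_trans)
        also have "\<dots> \<le> (SUP i. c i l)"
          by (rule SUP_upper) simp
        finally show "a l \<le> (SUP i. c i l)" .
      qed
    next
      fix i
      obtain x where "x \<in> X" "c i \<lless>\<^sub>R x"
        using c(2) unfolding Y_def by blast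
      then show "c i l \<le> (SUP f\<in>X. f l)"
        using far_below_imp_le[of "c i" x] by (intro SUP_upper2[of x]) (auto simp: le_fun_def)
    qed
  qed
qed

end

section \<open>Complements and decompositions of fractions\<close>

lemma fraction_le_iff: "0 < k \<Longrightarrow> fraction k s \<le> fraction k t \<longleftrightarrow> hat s \<le> hat t"
  by (simp add: le_fun_def fraction_def ennreal_inverse_mult_le_iff ennreal_mult_cancel_inverse)

lemma zero_in_fractions: "(\<lambda>_. 0) \<in> fractions"
  using fraction_in_fractions[of 1 0] by (simp add: fraction_def[abs_def] hat_def)

lemma fractions_sum:
  assumes "\<And>i. e i \<in> fractions"
  shows "(\<lambda>l. \<Sum>i<n::nat. e i l) \<in> fractions"
proof (induction n)
  case (Suc n)
  then show ?case
    using fractions_add[OF Suc assms[of n]] by simp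
qed (simp add: zero_in_fractions)

lemma far_below_scale:
  assumes "a \<lless>\<^sub>R b" "r \<in> \<rat>" "0 < r" and O3: "axiom_O3 TYPE('a::ordered_semigroup)"
  shows "(\<lambda>l::'a functional. ennreal r * a l) \<lless>\<^sub>R (\<lambda>l. ennreal r * b l)"
proof -
  obtain k s' s q where *: "0 < k" "s' \<lless> s" "0 < q" "q < 1" "\<And>l. a l \<le> ennreal q * fraction k s' l"
    "fraction k s \<le> b"
    using assms unfolding far_below_def by blast
  obtain m n :: nat where mn: "n \<noteq> 0" "\<bar>r\<bar> = real m / real n"
    using Rats_abs_nat_div_natE[OF assms(2)] by metis
  then have r: "r = real m / real n"
    using assms(3) by simp
  have "nmul m s' \<lless> nmul m s"
    using *(2) O3 unfolding axiom_O3_def by (induction m) (auto simp: nmul_Suc zero_way_below)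
  moreover have "ennreal r * a l \<le> ennreal q * fraction (n * k) (nmul m s') l" for l
    using mult_left_mono[OF *(5), of "ennreal r"] by (simp add: fraction_nmul r mult.left_commute)
  moreover have "fraction (n * k) (nmul m s) \<le> (\<lambda>l. ennreal r * b l)"
    using *(6) by (auto simp: le_fun_def fraction_nmul r intro: mult_left_mono)
  ultimately show ?thesis
    unfolding far_below_def using *(1,3,4) mn(1)
    by (intro exI[of _ "n * k"] exI[of _ "nmul m s'"] exI[of _ "nmul m s"] exI[of _ q]) auto
qed

section \<open>Transfer of O5 and O6 to fractions\<close>

context cu_semigroup
begin

text \<open>The bridge from pointwise order to \<open>S\<close>: the pointwise inequality between
  \<open>m s\<close> and \<open>k x\<close> becomes \<open>K p m s'' \<le> K q k x\<close> in
  \<open>S\<close>, by \<open>way_below_multiples\<close>. With \<open>j = K q k\<close> the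
  shrinking factor \<open>p / q\<close> is built into the numerators, so O5 and O6 apply to true
  inequalities.\<close>

lemma far_below_algebraic:
  fixes x :: 'a
  assumes "a \<lless>\<^sub>R b" "b \<le> fraction m x" "0 < m"
  obtains j s' s where "0 < j" "s' \<lless> s" "s \<le> nmul j x" "a \<le> fraction (j * m) s'"
    "fraction (j * m) s \<le> b"
proof -
  obtain k s' s p q where *: "0 < k" "s' \<lless> s" "0 < p" "p < q"
    "\<And>l. a l \<le> ennreal (real p / real q) * fraction k s' l" "fraction k s \<le> b"
    using far_belowE_rat[OF assms(1)] by metis
  obtain s'' where s'': "s' \<lless> s''" "s'' \<lless> s"
    using way_below_interpolate[OF O2 *(2)] .
  have "fraction (k * m) (nmul m s) \<le> fraction (k * m) (nmul k x)"
    using order_trans[OF *(6) assms(2)] fraction_cancel[of m k s] fraction_cancel[of k m x] *(1) assms(3)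
    by (simp add: mult.commute)
  then have "hat (nmul m s) \<le> hat (nmul k x)"
    using *(1) assms(3) by (simp add: fraction_le_iff)
  then obtain K where K: "0 < K" "nmul (K * p) (nmul m s'') \<le> nmul (K * q) (nmul k x)"
    using way_below_multiples[OF _ way_below_nmul[OF s''(2)] *(4)] by metis
  have eq: "fraction (K * q * k * m) (nmul (K * p) (nmul m t)) l = ennreal (real p / real q) * fraction k t l"
    for t :: 'a and l
    using K(1) fraction_nmul[of "K * q" "k * m" "K * p" "nmul m t" l] fraction_cancel[OF assms(3), of k t]
    by (simp add: mult.assoc mult.commute[of k m])
  show ?thesis
  proof (rule that[of "K * q * k" "nmul (K * p) (nmul m s')" "nmul (K * p) (nmul m s'')"])
    show "0 < K * q * k"
      using K(1) *(1,4) by simp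
    show "nmul (K * p) (nmul m s') \<lless> nmul (K * p) (nmul m s'')"
      by (intro way_below_nmul s'')
    show "nmul (K * p) (nmul m s'') \<le> nmul (K * q * k) x"
      using K(2) by (simp add: nmul_nmul)
    show "a \<le> fraction (K * q * k * m) (nmul (K * p) (nmul m s'))"
      unfolding le_fun_def eq using *(5) by blast
    show "fraction (K * q * k * m) (nmul (K * p) (nmul m s'')) \<le> b"
      unfolding le_fun_def eq
    proof
      fix l
      have "ennreal (real p / real q) * fraction k s'' l \<le> 1 * fraction k s l"
        using *(4) by (intro mult_mono fraction_mono way_below_imp_le[OF s''(2)]) auto
      also have "\<dots> \<le> b l"
        using *(6) by (simp add: le_fun_def)
      finally show "ennreal (real p / real q) * fraction k s'' l \<le> b l" .
    qed
  qed
qed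

text \<open>O5 for the numerators over the denominator \<open>j * m\<close>. The complement is
  inexact: it fits with \<open>f'\<close> below \<open>g\<close> but needs \<open>f\<close> to cover
  \<open>g\<close>.\<close>

lemma fractions_complement:
  fixes f g :: "'a functional \<Rightarrow> ennreal"
  assumes "f' \<lless>\<^sub>R f" "g \<in> fractions" "f \<le> g"
  obtains u where "u \<in> fractions" "\<And>l. f' l + u l \<le> g l" "\<And>l. g l \<le> f l + u l"
proof -
  obtain m x where g: "0 < m" "g = fraction m x"
    using assms(2) unfolding fractions_def by blast
  obtain j s' s where j: "0 < j" "s' \<lless> s" "s \<le> nmul j x" "f' \<le> fraction (j * m) s'"
    "fraction (j * m) s \<le> f"
    using far_below_algebraic[OF assms(1) _ g(1)] assms(3) g(2) by metis
  obtain r where r: "s' + r \<le> nmul j x" "nmul j x \<le> s + r"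
    using O5 j(2,3) unfolding axiom_O5_def by blast
  have gj: "g = fraction (j * m) (nmul j x)"
    using fraction_cancel[OF j(1), of m x] g(2) by simp
  show ?thesis
  proof (rule that[of "fraction (j * m) r"])
    show "fraction (j * m) r \<in> fractions"
      using g(1) j(1) by (intro fraction_in_fractions) simp
    fix l
    have "f' l + fraction (j * m) r l \<le> fraction (j * m) (s' + r) l"
      unfolding fraction_add using j(4) by (intro add_right_mono) (simp add: le_fun_def)
    also have "\<dots> \<le> g l"
      unfolding gj by (rule fraction_mono[OF r(1)])
    finally show "f' l + fraction (j * m) r l \<le> g l" .
    have "g l \<le> fraction (j * m) (s + r) l"
      unfolding gj by (rule fraction_mono[OF r(2)])
    also have "\<dots> \<le> f l + fraction (j * m) r l"
      unfolding fraction_add using j(5) by (intro add_right_mono) (simp add: le_fun_def)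
    finally show "g l \<le> f l + fraction (j * m) r l" .
  qed
qed

text \<open>O6 for the numerators over the denominator \<open>j * m\<close>, after \<open>g\<close>
  and \<open>h\<close> are given a common denominator.\<close>

lemma fractions_O6:
  fixes f g h :: "'a functional \<Rightarrow> ennreal"
  assumes "f' \<lless>\<^sub>R f" "g \<in> fractions" "h \<in> fractions" "\<And>l. f l \<le> g l + h l"
  obtains g' h' where "g' \<in> fractions" "h' \<in> fractions" "\<And>l. f' l \<le> g' l + h' l"
    "g' \<le> g" "g' \<le> f" "h' \<le> h" "h' \<le> f"
proof -
  obtain m x y where gh: "0 < m" "g = fraction m x" "h = fraction m y"
    using fractions_common_denominator[OF assms(2,3)] by metis
  have "f \<le> fraction m (x + y)"
    using assms(4) by (simp add: le_fun_def fraction_add gh)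
  then obtain j s' s where j: "0 < j" "s' \<lless> s" "s \<le> nmul j (x + y)" "f' \<le> fraction (j * m) s'"
    "fraction (j * m) s \<le> f"
    using far_below_algebraic[OF assms(1) _ gh(1)] by metis
  obtain r t where rt: "s' \<le> r + t" "r \<le> nmul j x" "r \<le> s" "t \<le> nmul j y" "t \<le> s"
    using O6 j(2,3) unfolding axiom_O6_def nmul_add_right by blast
  have N: "fraction (j * m) v \<in> fractions" for v :: 'a
    using gh(1) j(1) by (intro fraction_in_fractions) simp
  have le: "fraction (j * m) v \<le> fraction (j * m) w" if "v \<le> w" for v w :: 'a
    using fraction_mono[OF that] by (simp add: le_fun_def)
  show ?thesis
  proof (rule that[of "fraction (j * m) r" "fraction (j * m) t", OF N N])
    show "f' l \<le> fraction (j * m) r l + fraction (j * m) t l" for l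
      using j(4) fraction_mono[OF rt(1), of "j * m" l] by (auto simp: le_fun_def fraction_add intro: order_trans)
    show "fraction (j * m) r \<le> g" "fraction (j * m) t \<le> h"
      using le[OF rt(2)] le[OF rt(4)] fraction_cancel[OF j(1), of m x] fraction_cancel[OF j(1), of m y] by (simp_all add: gh)
    show "fraction (j * m) r \<le> f" "fraction (j * m) t \<le> f"
      using le[OF rt(3)] le[OF rt(5)] j(5) by (auto intro: order_trans)
  qed
qed

text \<open>Averaging a chain of \<open>n\<close> elements between \<open>f'\<close> and \<open>f\<close> and shifting it by one step changes
  the average by at most \<open>f / n\<close>.\<close>

lemma far_below_averages:
  fixes f :: "'a functional \<Rightarrow> ennreal"
  assumes "f' \<lless>\<^sub>R f" "0 < \<epsilon>"
  obtains a' a where "a' \<in> fractions" "a \<in> fractions" "a' \<lless>\<^sub>R a" "f' \<le> a'" "a \<le> f"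
    "\<And>l. a l \<le> a' l + ennreal \<epsilon> * f l"
proof -
  have "\<exists>e. \<forall>i::nat. (e i \<in> fractions \<and> f' \<lless>\<^sub>R e i \<and> e i \<lless>\<^sub>R f) \<and> e i \<lless>\<^sub>R e (Suc i)"
  proof (rule dependent_nat_choice)
    show "\<exists>x. x \<in> fractions \<and> f' \<lless>\<^sub>R x \<and> x \<lless>\<^sub>R f"
      using far_below_interpolate[OF assms(1)] by metis
    fix x assume x: "x \<in> fractions \<and> f' \<lless>\<^sub>R x \<and> x \<lless>\<^sub>R f"
    then obtain y where y: "y \<in> fractions" "x \<lless>\<^sub>R y" "y \<lless>\<^sub>R f"
      using far_below_interpolate[of x f] by metis
    moreover have "f' \<lless>\<^sub>R y"
      using x y(2) far_below_mono[of f' f' x y] far_below_imp_le by blast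
    ultimately show "\<exists>y. (y \<in> fractions \<and> f' \<lless>\<^sub>R y \<and> y \<lless>\<^sub>R f) \<and> x \<lless>\<^sub>R y"
      by blast
  qed
  then obtain e where e: "\<And>i. e i \<in> fractions" "\<And>i. f' \<lless>\<^sub>R e i" "\<And>i. e i \<lless>\<^sub>R f"
    "\<And>i::nat. e i \<lless>\<^sub>R e (Suc i)"
    by blast
  obtain n where n: "0 < n" "1 / real n < \<epsilon>"
    using reals_Archimedean[OF assms(2)] by (metis inverse_eq_divide zero_less_Suc)
  have f'e: "f' l \<le> e i l" and ef: "e i l \<le> f l" for i l
    using far_below_imp_le[OF e(2)] far_below_imp_le[OF e(3)] by (auto simp: le_fun_def)
  define avg where "avg j l = ennreal (1 / real n) * (\<Sum>i<n. e (i + j) l)" for j l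
  have const: "ennreal (1 / real n) * (\<Sum>i<n. x) = x" for x :: ennreal
    using n(1) by (simp add: ennreal_of_nat_eq_real_of_nat flip: mult.assoc ennreal_mult')
  have avg: "avg j \<in> fractions" for j
    unfolding avg_def[abs_def] by (intro fractions_scale fractions_sum e(1)) auto
  show ?thesis
  proof (rule that[of "avg 0" "avg 1", OF avg avg])
    show "f' \<le> avg 0"
    proof (rule le_funI)
      fix l
      have "ennreal (1 / real n) * (\<Sum>i<n. f' l) \<le> avg 0 l"
        unfolding avg_def by (intro mult_left_mono sum_mono f'e) auto
      then show "f' l \<le> avg 0 l"
        unfolding const .
    qed
    show "avg 1 \<le> f"
    proof (rule le_funI)
      fix l
      have "avg 1 l \<le> ennreal (1 / real n) * (\<Sum>i<n. f l)"
        unfolding avg_def by (intro mult_left_mono sum_mono ef) auto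
      then show "avg 1 l \<le> f l"
        unfolding const .
    qed
    show "avg 1 l \<le> avg 0 l + ennreal \<epsilon> * f l" for l
    proof -
      \<comment> \<open>The shifted sum loses \<open>e 0\<close> and gains \<open>e n\<close>.
        Adding \<open>e 0\<close> first avoids a subtraction of possibly infinite values.\<close>
      have "(\<Sum>i<n. e (i + 1) l) \<le> e 0 l + (\<Sum>i<n. e (Suc i) l)"
        by (simp add: le_add_left add_increasing)
      also have "\<dots> = (\<Sum>i<n. e (i + 0) l) + e n l"
        using sum.lessThan_Suc_shift[of "\<lambda>i. e i l" n] sum.lessThan_Suc[of "\<lambda>i. e i l" n] by simp
      also have "\<dots> \<le> (\<Sum>i<n. e (i + 0) l) + f l"
        by (intro add_left_mono ef)
      finally have "avg 1 l \<le> ennreal (1 / real n) * ((\<Sum>i<n. e (i + 0) l) + f l)"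
        unfolding avg_def by (intro mult_left_mono) auto
      also have "\<dots> = avg 0 l + ennreal (1 / real n) * f l"
        unfolding avg_def by (simp add: distrib_left)
      also have "\<dots> \<le> avg 0 l + ennreal \<epsilon> * f l"
        using n(2) by (intro add_left_mono mult_right_mono ennreal_leI) auto
      finally show ?thesis .
    qed
    have "(\<lambda>l. \<Sum>i<j. e (i + 0) l) \<lless>\<^sub>R (\<lambda>l. \<Sum>i<j. e (i + 1) l)" for j
    proof (induction j)
      case (Suc j)
      show ?case
        using far_below_add[OF Suc e(4)[of j] O3] by simp
    qed (simp add: zero_far_below)
    then show "avg 0 \<lless>\<^sub>R avg 1"
      unfolding avg_def[abs_def] using n(1) O3 by (intro far_below_scale) auto
  qed
qed

text \<open>The complement of the average \<open>a'\<close> inside \<open>g\<close> has error at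
  most \<open>\<epsilon>\<close> times \<open>f\<close>. The lower element is chosen before
  \<open>g\<close>, so one element can have complements in several upper bounds of
  \<open>f\<close>.\<close>

lemma approx_complement:
  fixes f :: "'a functional \<Rightarrow> ennreal"
  assumes "f' \<lless>\<^sub>R f" "0 < \<epsilon>"
  obtains a where "a \<in> fractions" "f' \<le> a" "a \<le> f"
    "\<And>g. g \<in> fractions \<Longrightarrow> f \<le> g \<Longrightarrow>
      \<exists>u\<in>fractions. (\<forall>l. a l + u l \<le> g l) \<and> (\<forall>l. g l \<le> a l + u l + ennreal \<epsilon> * f l)"
proof -
  obtain a' a where a: "a' \<in> fractions" "a \<in> fractions" "a' \<lless>\<^sub>R a" "f' \<le> a'" "a \<le> f"
    "\<And>l. a l \<le> a' l + ennreal \<epsilon> * f l"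
    using far_below_averages[OF assms] by metis
  show ?thesis
  proof (rule that[of a', OF a(1,4)])
    show "a' \<le> f"
      using far_below_imp_le[OF a(3)] a(5) by (rule order_trans)
    fix g assume g: "g \<in> fractions" "f \<le> g"
    obtain u where u: "u \<in> fractions" "\<And>l. a' l + u l \<le> g l" "\<And>l. g l \<le> a l + u l"
      using fractions_complement[OF a(3) g(1) order_trans[OF a(5) g(2)]] by metis
    have "g l \<le> a' l + u l + ennreal \<epsilon> * f l" for l
      using order_trans[OF u(3) add_right_mono[OF a(6)]] by (simp add: ac_simps)
    with u show "\<exists>u\<in>fractions. (\<forall>l. a' l + u l \<le> g l) \<and> (\<forall>l. g l \<le> a' l + u l + ennreal \<epsilon> * f l)"
      by blast
  qed
qed

end

lemma ennreal_le_inverse_mult_iff: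
  "0 < k \<Longrightarrow> x \<le> ennreal (1 / k) * y \<longleftrightarrow> ennreal k * x \<le> y"
  using ennreal_inverse_mult_le_iff[of "1 / k" x y] by simp

text \<open>Cancellation for finite \<open>x\<close>. In the applications an infinite cancelled term
  makes the error term on the right infinite, which is the second hypothesis.\<close>

lemma ennreal_le_of_add_le:
  fixes x y z :: ennreal
  assumes "x + y \<le> x + z" "x = top \<Longrightarrow> z = top"
  shows "y \<le> z"
  using assms by (auto simp: ennreal_add_left_cancel_le)

section \<open>Riesz decomposition and interpolation\<close>

context cu_semigroup
begin

text \<open>The lower bound of \<open>riesz_decomposition\<close> is first reached up to an additive error
  \<open>\<epsilon> z\<^sub>1\<close>. The error is then absorbed by adding a small multiple of the
  decomposition of \<open>z\<^sub>1\<close> given by O6, whose summands add up to at most \<open>2 z\<close>.\<close>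

lemma riesz_decomposition:
  fixes f h z :: "'a functional \<Rightarrow> ennreal"
  assumes "z' \<lless>\<^sub>R z" and f: "f \<in> fractions" and h: "h \<in> fractions"
    and zfh: "\<And>l. z l \<le> f l + h l"
  obtains f1 h1 where "f1 \<in> fractions" "h1 \<in> fractions" "f1 \<le> f" "h1 \<le> h"
    "\<And>l. f1 l + h1 l \<le> z l" "\<And>l. z' l \<le> f1 l + h1 l"
proof -
  obtain d where d: "0 < d" "d < 1" "d \<in> \<rat>" and z'd: "(\<lambda>l. ennreal (1 + d) * z' l) \<lless>\<^sub>R z"
    using far_below_slack[OF assms(1)] by metis
  \<comment> \<open>Two errors \<open>\<epsilon> * z1\<close> will occur; together they are
    \<open>d / 2\<close> times \<open>z1\<close>, which \<open>d / 2\<close> times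
    \<open>f' + h'\<close> covers.\<close>
  define \<epsilon> where "\<epsilon> = d / 4"
  have \<epsilon>: "0 < \<epsilon>" "\<epsilon> \<in> \<rat>" "0 \<le> \<epsilon>"
    using d by (auto simp: \<epsilon>_def)
  obtain z1 where z1: "z1 \<in> fractions" "(\<lambda>l. ennreal (1 + d) * z' l) \<lless>\<^sub>R z1" "z1 \<lless>\<^sub>R z"
    using far_below_interpolate[OF z'd] by metis
  obtain z0 where z0: "(\<lambda>l. ennreal (1 + d) * z' l) \<lless>\<^sub>R z0" "z0 \<lless>\<^sub>R z1"
    using far_below_interpolate[OF z1(2)] by metis
  have z1z: "z1 l \<le> z l" for l
    using far_below_imp_le[OF z1(3)] by (rule le_funD)
  obtain s'' s where s: "s \<in> fractions" "s'' \<lless>\<^sub>R s" "z0 \<le> s''" "s \<le> z1"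
    and s_s'': "\<And>l. s l \<le> s'' l + ennreal \<epsilon> * z1 l"
    using far_below_averages[OF z0(2) \<epsilon>(1)] by metis
  obtain s' where s': "s'' \<lless>\<^sub>R s'" "s' \<lless>\<^sub>R s"
    using far_below_interpolate[OF s(2)] by metis
  have sz1: "s l \<le> z1 l" for l
    using s(4) by (rule le_funD)
  have "s l \<le> f l + h l" for l
    using sz1[of l] z1z[of l] zfh[of l] by (meson order_trans)
  \<comment> \<open>Each of \<open>p\<close> and \<open>q\<close> is below \<open>s\<close>, but
    their sum need not be. So \<open>p\<close> is lowered to \<open>a\<close>, and \<open>q\<close>
    will be replaced by some \<open>y\<close> below both \<open>q\<close> and the approximate
    complement \<open>k\<close> of \<open>a\<close> in \<open>s\<close>.\<close>
  then obtain p q where pq: "p \<in> fractions" "q \<in> fractions" "\<And>l. s' l \<le> p l + q l"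
    "p \<le> f" "p \<le> s" "q \<le> h" "q \<le> s"
    using fractions_O6[OF s'(2) f h] by metis
  obtain p' q' where p'q': "p' \<lless>\<^sub>R p" "q' \<lless>\<^sub>R q" "\<And>l. s'' l \<le> p' l + q' l"
    using far_below_add_split[OF s'(1) pq(1,2,3)] by metis
  obtain a where a: "a \<in> fractions" "p' \<le> a" "a \<le> p"
    "\<And>g. g \<in> fractions \<Longrightarrow> p \<le> g \<Longrightarrow>
      \<exists>u\<in>fractions. (\<forall>l. a l + u l \<le> g l) \<and> (\<forall>l. g l \<le> a l + u l + ennreal \<epsilon> * p l)"
    using approx_complement[OF p'q'(1) \<epsilon>(1)] by metis
  obtain k where k: "k \<in> fractions" "\<And>l. a l + k l \<le> s l" "\<And>l. s l \<le> a l + k l + ennreal \<epsilon> * p l"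
    using a(4)[OF s(1) pq(5)] by metis
  \<comment> \<open>Cancelling \<open>a\<close> from \<open>a + k \<le> s\<close> and
    \<open>s'' \<le> a + q\<close> bounds \<open>k\<close> by \<open>q\<close>, up to the difference
    between \<open>s\<close> and \<open>s''\<close>.\<close>
  have kq: "k l \<le> q l + ennreal \<epsilon> * z1 l" for l
  proof (rule ennreal_le_of_add_le)
    have "a l + k l \<le> s'' l + ennreal \<epsilon> * z1 l"
      using k(2) s_s'' by (rule order_trans)
    also have "\<dots> \<le> (a l + q l) + ennreal \<epsilon> * z1 l"
    proof (rule add_right_mono)
      show "s'' l \<le> a l + q l"
        using order_trans[OF p'q'(3)] add_mono[OF le_funD[OF a(2)] le_funD[OF far_below_imp_le[OF p'q'(2)]]]
        by blast
    qed
    finally show "a l + k l \<le> a l + (q l + ennreal \<epsilon> * z1 l)"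
      by (simp add: ac_simps)
    have "a l \<le> z1 l"
      using a(3) pq(5) s(4) by (meson le_funD order_trans)
    then show "q l + ennreal \<epsilon> * z1 l = top" if "a l = top"
      using that \<epsilon>(1) by (auto simp: top_unique ennreal_mult_top)
  qed
  have z0_le: "z0 l \<le> k l + (a l + ennreal \<epsilon> * p l)" for l
    using order_trans[OF le_funD[OF s(3)] order_trans[OF le_funD[OF far_below_imp_le[OF s(2)]] k(3)]]
    by (simp add: ac_simps)
  obtain k' w where k': "k' \<lless>\<^sub>R k" "w \<lless>\<^sub>R (\<lambda>l. a l + ennreal \<epsilon> * p l)"
    "\<And>l. ennreal (1 + d) * z' l \<le> k' l + w l"
    using far_below_add_split[OF z0(1) k(1) fractions_add[OF a(1) fractions_scale[OF pq(1) \<epsilon>(2,3)]] z0_le]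
    by metis
  \<comment> \<open>O6 splits \<open>k\<close> along this bound; \<open>y\<close> is the wanted
    second summand and \<open>x\<close> belongs to the error.\<close>
  obtain y x where y: "y \<in> fractions" "\<And>l. k' l \<le> y l + x l" "y \<le> q" "y \<le> k"
    and x: "x \<le> (\<lambda>l. ennreal \<epsilon> * z1 l)"
    using fractions_O6[OF k'(1) pq(2) fractions_scale[OF z1(1) \<epsilon>(2,3)] kq] by metis
  obtain f' h' where f'h': "f' \<in> fractions" "h' \<in> fractions" "\<And>l. z1 l \<le> f' l + h' l"
    "f' \<le> f" "f' \<le> z" "h' \<le> h" "h' \<le> z"
    using fractions_O6[OF z1(3) f h zfh] by metis
  define f1 where "f1 l = ennreal (1 / (1 + d)) * (a l + ennreal (d / 2) * f' l)" for l
  define h1 where "h1 l = ennreal (1 / (1 + d)) * (y l + ennreal (d / 2) * h' l)" for l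
  have sum: "f1 l + h1 l = ennreal (1 / (1 + d)) * (a l + y l + ennreal (d / 2) * (f' l + h' l))" for l
    by (simp add: f1_def h1_def distrib_left add_ac)
  \<comment> \<open>The bound \<open>b' \<le> 2 c\<close> with weight \<open>d / 2\<close> costs at
    most \<open>d\<close> times \<open>c\<close>, which dividing by \<open>1 + d\<close>
    compensates.\<close>
  have absorb: "ennreal (1 / (1 + d)) * (b + ennreal (d / 2) * b') \<le> c" if "b \<le> c" "b' \<le> c + c"
    for b b' c :: ennreal
  proof -
    have "b + ennreal (d / 2) * b' \<le> c + ennreal (d / 2) * (c + c)"
      using that by (intro add_mono mult_left_mono) auto
    also have "ennreal (d / 2) * (c + c) = ennreal (d / 2 + d / 2) * c"
      using d(1) by (subst ennreal_plus) (auto simp: distrib_left distrib_right)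
    finally show ?thesis
      using d(1) by (simp add: ennreal_inverse_mult_le_iff distrib_right)
  qed
  show ?thesis
  proof (rule that[of f1 h1])
    have "1 / (1 + d) \<in> \<rat>" "0 \<le> 1 / (1 + d)" "d / 2 \<in> \<rat>" "0 \<le> d / 2"
      using d by auto
    then show "f1 \<in> fractions" "h1 \<in> fractions"
      unfolding f1_def[abs_def] h1_def[abs_def]
      by (intro fractions_scale fractions_add a(1) y(1) f'h'(1,2); simp)+
    show "f1 \<le> f"
      unfolding f1_def using a(3) pq(4) f'h'(4)
      by (intro le_funI absorb) (auto simp: le_fun_def intro: order_trans add_increasing)
    show "h1 \<le> h"
      unfolding h1_def using y(3) pq(6) f'h'(6)
      by (intro le_funI absorb) (auto simp: le_fun_def intro: order_trans add_increasing)
    show "f1 l + h1 l \<le> z l" for l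
      unfolding sum
    proof (rule absorb)
      have "a l + y l \<le> a l + k l"
        using y(4) by (intro add_left_mono) (rule le_funD)
      then show "a l + y l \<le> z l"
        using k(2)[of l] sz1[of l] z1z[of l] by (meson order_trans)
      show "f' l + h' l \<le> z l + z l"
        using f'h'(5,7) by (intro add_mono) (auto simp: le_fun_def)
    qed
    show "z' l \<le> f1 l + h1 l" for l
    proof -
      have "ennreal (1 + d) * z' l \<le> (y l + ennreal \<epsilon> * z1 l) + (a l + ennreal \<epsilon> * z1 l)"
      proof (rule order_trans[OF k'(3) add_mono])
        show "k' l \<le> y l + ennreal \<epsilon> * z1 l"
          using y(2)[of l] add_left_mono[OF le_funD[OF x, of l], of "y l"] by (rule order_trans)
        have "p l \<le> z1 l"
          using pq(5) s(4) by (meson le_funD order_trans)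
        then have "a l + ennreal \<epsilon> * p l \<le> a l + ennreal \<epsilon> * z1 l"
          by (intro add_left_mono mult_left_mono) auto
        then show "w l \<le> a l + ennreal \<epsilon> * z1 l"
          using le_funD[OF far_below_imp_le[OF k'(2)], of l] by (meson order_trans)
      qed
      also have "\<dots> = a l + y l + (ennreal \<epsilon> * z1 l + ennreal \<epsilon> * z1 l)"
        by (simp add: ac_simps)
      also have "ennreal \<epsilon> * z1 l + ennreal \<epsilon> * z1 l = ennreal (d / 2) * z1 l"
      proof -
        have "ennreal \<epsilon> + ennreal \<epsilon> = ennreal (d / 2)"
          using d(1) by (simp add: \<epsilon>_def flip: ennreal_plus)
        then show ?thesis
          by (simp flip: distrib_right)
      qed
      also have "a l + y l + ennreal (d / 2) * z1 l \<le> a l + y l + ennreal (d / 2) * (f' l + h' l)"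
        by (intro add_left_mono mult_left_mono f'h'(3)) auto
      finally show ?thesis
        unfolding sum using d(1) by (simp add: ennreal_le_inverse_mult_iff)
    qed
  qed
qed

text \<open>The interpolant is roughly \<open>\<alpha> + y\<close>, where \<open>\<alpha>\<close>
  approximates \<open>a\<close> and \<open>y\<close> lies below its complements \<open>c\<close> in
  \<open>v\<close> and \<open>e\<close> in \<open>w\<close>. To reach \<open>b\<close>, split
  \<open>b\<close> along \<open>\<alpha>' + c\<close> into \<open>a1 + c1\<close>, and remove from
  \<open>c1\<close> the part that fits into what \<open>a1\<close> leaves of
  \<open>\<alpha>'\<close>; the remainder \<open>y\<close> is below \<open>e\<close> because
  \<open>b \<le> w\<close>.\<close>

lemma riesz_interpolation:
  fixes a b v w :: "'a functional \<Rightarrow> ennreal"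
  assumes "a' \<lless>\<^sub>R a" "b' \<lless>\<^sub>R b"
    and mem: "a \<in> fractions" "v \<in> fractions" "w \<in> fractions"
    and le: "a \<le> v" "a \<le> w" "b \<le> v" "b \<le> w"
  obtains z where "z \<in> fractions" "a' \<le> z" "b' \<le> z" "z \<le> v" "z \<le> w"
proof -
  obtain d1 where d1: "0 < d1" "d1 < 1" "d1 \<in> \<rat>" "(\<lambda>l. ennreal (1 + d1) * a' l) \<lless>\<^sub>R a"
    using far_below_slack[OF assms(1)] by metis
  obtain d2 where d2: "0 < d2" "d2 < 1" "d2 \<in> \<rat>" "(\<lambda>l. ennreal (1 + d2) * b' l) \<lless>\<^sub>R b"
    using far_below_slack[OF assms(2)] by metis
  define d where "d = min d1 d2"
  have d: "0 < d" "d < 1" "d \<in> \<rat>" "0 \<le> d"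
    using d1 d2 by (auto simp: d_def min_def)
  have a'd: "(\<lambda>l. ennreal (1 + d) * a' l) \<lless>\<^sub>R a"
    by (rule far_below_mono[OF _ d1(4) order_refl])
       (auto simp: d_def le_fun_def intro!: mult_right_mono ennreal_leI)
  have b'd: "(\<lambda>l. ennreal (1 + d) * b' l) \<lless>\<^sub>R b"
    by (rule far_below_mono[OF _ d2(4) order_refl])
       (auto simp: d_def le_fun_def intro!: mult_right_mono ennreal_leI)
  \<comment> \<open>The estimate of \<open>b'\<close> collects one error
    \<open>\<epsilon> * a\<close> from \<open>\<alpha>'\<close> and two from
    \<open>a1 \<le> a + a\<close>, hence the third of \<open>d\<close>.\<close>
  define \<epsilon> where "\<epsilon> = d / 3"
  have \<epsilon>: "0 < \<epsilon>" "\<epsilon> \<in> \<rat>" "0 \<le> \<epsilon>" "\<epsilon> \<le> 1"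
    using d by (auto simp: \<epsilon>_def)
  obtain \<alpha> where \<alpha>: "\<alpha> \<in> fractions" "(\<lambda>l. ennreal (1 + d) * a' l) \<le> \<alpha>" "\<alpha> \<le> a"
    "\<And>g. g \<in> fractions \<Longrightarrow> a \<le> g \<Longrightarrow>
      \<exists>u\<in>fractions. (\<forall>l. \<alpha> l + u l \<le> g l) \<and> (\<forall>l. g l \<le> \<alpha> l + u l + ennreal \<epsilon> * a l)"
    using approx_complement[OF a'd \<epsilon>(1)] by metis
  obtain c where c: "c \<in> fractions" "\<And>l. \<alpha> l + c l \<le> v l" "\<And>l. v l \<le> \<alpha> l + c l + ennreal \<epsilon> * a l"
    using \<alpha>(4)[OF mem(2) le(1)] by metis
  obtain e where e: "e \<in> fractions" "\<And>l. \<alpha> l + e l \<le> w l" "\<And>l. w l \<le> \<alpha> l + e l + ennreal \<epsilon> * a l"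
    using \<alpha>(4)[OF mem(3) le(2)] by metis
  \<comment> \<open>Including the error in the first summand makes
    \<open>v \<le> \<alpha>' + c\<close> and \<open>w \<le> \<alpha>' + e\<close> exact.\<close>
  define \<alpha>' where "\<alpha>' l = \<alpha> l + ennreal \<epsilon> * a l" for l
  have \<alpha>': "\<alpha>' \<in> fractions"
    unfolding \<alpha>'_def[abs_def] by (intro fractions_add fractions_scale \<alpha>(1) mem(1) \<epsilon>)
  obtain \<beta> where \<beta>: "(\<lambda>l. ennreal (1 + d) * b' l) \<lless>\<^sub>R \<beta>" "\<beta> \<lless>\<^sub>R b"
    using far_below_interpolate[OF b'd] by metis
  have b_le: "b l \<le> \<alpha>' l + c l" for l
    using order_trans[OF le_funD[OF le(3)] c(3)] by (simp add: \<alpha>'_def ac_simps)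
  obtain a1 c1 where a1: "a1 \<in> fractions" "c1 \<in> fractions" "a1 \<le> \<alpha>'" "c1 \<le> c"
    "\<And>l. a1 l + c1 l \<le> b l" "\<And>l. \<beta> l \<le> a1 l + c1 l"
    using riesz_decomposition[OF \<beta>(2) \<alpha>' c(1) b_le] by metis
  obtain a1' c1' where a1': "a1' \<lless>\<^sub>R a1" "c1' \<lless>\<^sub>R c1" "\<And>l. ennreal (1 + d) * b' l \<le> a1' l + c1' l"
    using far_below_add_split[OF \<beta>(1) a1(1,2,6)] by metis
  obtain \<alpha>1 where \<alpha>1: "a1' \<le> \<alpha>1" "\<alpha>1 \<le> a1"
    "\<And>g. g \<in> fractions \<Longrightarrow> a1 \<le> g \<Longrightarrow>
      \<exists>u\<in>fractions. (\<forall>l. \<alpha>1 l + u l \<le> g l) \<and> (\<forall>l. g l \<le> \<alpha>1 l + u l + ennreal \<epsilon> * a1 l)"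
    using approx_complement[OF a1'(1) \<epsilon>(1)] by metis
  obtain a2 where a2: "a2 \<in> fractions" "\<And>l. \<alpha>1 l + a2 l \<le> \<alpha>' l"
    "\<And>l. \<alpha>' l \<le> \<alpha>1 l + a2 l + ennreal \<epsilon> * a1 l"
    using \<alpha>1(3)[OF \<alpha>' a1(3)] by metis
  \<comment> \<open>\<open>\<alpha>1\<close> is cancelled from
    \<open>\<alpha>1 + c1 \<le> b \<le> w\<close>, with \<open>w\<close> bounded through the
    complement \<open>a2\<close> of \<open>\<alpha>1\<close> in \<open>\<alpha>'\<close>.\<close>
  have c1_le: "c1 l \<le> (a2 l + ennreal \<epsilon> * a1 l) + e l" for l
  proof (rule ennreal_le_of_add_le)
    have "\<alpha>1 l + c1 l \<le> a1 l + c1 l"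
      using \<alpha>1(2) by (intro add_right_mono) (rule le_funD)
    also have "\<dots> \<le> w l"
      using a1(5)[of l] le_funD[OF le(4), of l] by (rule order_trans)
    also have "\<dots> \<le> \<alpha>' l + e l"
      using e(3)[of l] by (simp add: \<alpha>'_def ac_simps)
    also have "\<dots> \<le> (\<alpha>1 l + a2 l + ennreal \<epsilon> * a1 l) + e l"
      by (intro add_right_mono a2(3))
    finally show "\<alpha>1 l + c1 l \<le> \<alpha>1 l + ((a2 l + ennreal \<epsilon> * a1 l) + e l)"
      by (simp add: ac_simps)
    show "a2 l + ennreal \<epsilon> * a1 l + e l = top" if "\<alpha>1 l = top"
      using le_funD[OF \<alpha>1(2), of l] that \<epsilon>(1) by (auto simp: top_unique ennreal_mult_top)
  qed
  obtain x y where y: "y \<in> fractions" "\<And>l. c1' l \<le> x l + y l" "y \<le> e" "y \<le> c1"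
    and x: "x \<le> (\<lambda>l. a2 l + ennreal \<epsilon> * a1 l)"
    using fractions_O6[OF a1'(2) fractions_add[OF a2(1) fractions_scale[OF a1(1) \<epsilon>(2,3)]] e(1) c1_le]
    by metis
  \<comment> \<open>The term \<open>d * a\<close> provides room for the errors, and the factor
    \<open>1 / (1 + d)\<close> brings the sum back below \<open>v\<close> and
    \<open>w\<close>.\<close>
  define z where "z l = ennreal (1 / (1 + d)) * (\<alpha> l + y l + ennreal d * a l)" for l
  have upper: "z \<le> g" if "\<And>l. \<alpha> l + y l \<le> g l" "a \<le> g" for g
  proof (rule le_funI)
    fix l
    have "\<alpha> l + y l + ennreal d * a l \<le> g l + ennreal d * g l"
      using that(2) by (intro add_mono mult_left_mono that(1)) (auto simp: le_fun_def)
    then show "z l \<le> g l"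
      using d(1) by (simp add: z_def ennreal_inverse_mult_le_iff distrib_right)
  qed
  show ?thesis
  proof (rule that[of z])
    show "z \<in> fractions"
      unfolding z_def[abs_def] using d
      by (intro fractions_scale fractions_add \<alpha>(1) y(1) mem(1)) auto
    show "a' \<le> z"
    proof (rule le_funI)
      fix l
      have "ennreal (1 + d) * a' l \<le> \<alpha> l + y l + ennreal d * a l"
        using le_funD[OF \<alpha>(2), of l] by (simp add: add.assoc add_increasing2)
      then show "a' l \<le> z l"
        using d(1) by (simp add: z_def ennreal_le_inverse_mult_iff)
    qed
    show "b' \<le> z"
    proof (rule le_funI)
      fix l
      have a1_le: "a1 l \<le> a l + a l"
      proof -
        have "ennreal \<epsilon> * a l \<le> 1 * a l"
          using \<epsilon>(4) by (intro mult_right_mono) auto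
        then have "\<alpha>' l \<le> a l + a l"
          unfolding \<alpha>'_def using \<alpha>(3) by (intro add_mono) (auto simp: le_fun_def)
        with le_funD[OF a1(3), of l] show ?thesis
          by (rule order_trans)
      qed
      have "ennreal (1 + d) * b' l \<le> \<alpha>1 l + ((a2 l + ennreal \<epsilon> * a1 l) + y l)"
        using \<alpha>1(1) x by (intro order_trans[OF a1'(3)] add_mono order_trans[OF y(2)])
          (auto simp: le_fun_def)
      also have "\<dots> = (\<alpha>1 l + a2 l) + ennreal \<epsilon> * a1 l + y l"
        by (simp add: ac_simps)
      also have "\<dots> \<le> \<alpha>' l + ennreal \<epsilon> * (a l + a l) + y l"
        by (intro add_mono a2(2) mult_left_mono a1_le) auto
      also have "\<dots> = \<alpha> l + y l + (ennreal \<epsilon> + ennreal \<epsilon> + ennreal \<epsilon>) * a l"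
        by (simp add: \<alpha>'_def distrib_left distrib_right add_ac)
      also have "ennreal \<epsilon> + ennreal \<epsilon> + ennreal \<epsilon> = ennreal d"
        using d(1) by (simp add: \<epsilon>_def flip: ennreal_plus)
      finally show "b' l \<le> z l"
        using d(1) by (simp add: z_def ennreal_le_inverse_mult_iff)
    qed
    show "z \<le> v"
    proof (rule upper[OF _ le(1)])
      fix l
      have "\<alpha> l + y l \<le> \<alpha> l + c l"
        using y(4) a1(4) by (intro add_left_mono) (meson le_funD order_trans)
      then show "\<alpha> l + y l \<le> v l"
        using c(2)[of l] by (rule order_trans)
    qed
    show "z \<le> w"
    proof (rule upper[OF _ le(2)])
      fix l
      have "\<alpha> l + y l \<le> \<alpha> l + e l"
        using y(3) by (intro add_left_mono) (rule le_funD)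
      then show "\<alpha> l + y l \<le> w l"
        using e(2)[of l] by (rule order_trans)
    qed
  qed
qed

end

section \<open>Infima\<close>

lemma ennreal_le_mult_epsilon:
  fixes x y :: ennreal
  assumes "\<And>d. 0 < d \<Longrightarrow> d \<in> \<rat> \<Longrightarrow> x \<le> y + ennreal d * y"
  shows "x \<le> y"
proof (rule le_mult_one_interval_ennreal)
  fix r :: real assume r: "0 < r" "r < 1"
  obtain d where d: "d \<in> \<rat>" "0 < d" "d < 1 / r - 1"
    using Rats_dense_in_real[of 0 "1 / r - 1"] r by auto
  have "ennreal r * x \<le> ennreal r * (ennreal (1 + d) * y)"
    using assms[OF d(2,1)] d(2) by (intro mult_left_mono) (auto simp: distrib_right)
  also have "\<dots> = ennreal (r * (1 + d)) * y"
    using r(1) by (simp only: ennreal_mult' mult.assoc less_imp_le)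
  also have "\<dots> \<le> 1 * y"
  proof (rule mult_right_mono)
    have "r * (1 + d) \<le> 1"
      using d(3) r(1) by (simp add: field_simps)
    then show "ennreal (r * (1 + d)) \<le> 1"
      by (metis ennreal_1 ennreal_leI)
  qed simp
  finally show "ennreal r * x \<le> y"
    by simp
qed

lemma realification_inf_eqI:
  "isGlb realification {f, g} h \<Longrightarrow> f \<sqinter>\<^sub>R g = h"
  unfolding realification_inf_def
  by (rule the_equality) (auto intro: antisym isGlb_le_isLb isGlb_isLb)

section \<open>Existence, continuity and additivity of infima\<close>

context cu_semigroup
begin

text \<open>The pointwise supremum of all common lower bounds is the infimum as soon as it lies in
  \<open>realification\<close>. This needs directedness of \<open>X\<close>, which comes from
  interpolating between fractions far below \<open>x\<close>, \<open>y\<close> and fractions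
  \<open>v\<close>, \<open>w\<close> far below \<open>f\<close>, \<open>g\<close>.\<close>

lemma isGlb_realification:
  fixes f g :: "'a functional \<Rightarrow> ennreal"
  assumes D: "countable D" "dense_subset (D :: 'a set)"
    and f: "f \<in> realification" and g: "g \<in> realification"
  defines "X \<equiv> {u \<in> realification. u \<le> f \<and> u \<le> g}"
  shows "isGlb realification {f, g} (\<lambda>l. SUP u\<in>X. u l)"
proof -
  have "(\<lambda>_. 0) \<in> X"
    unfolding X_def using fractions_subset_realification[OF zero_in_fractions]
    by (simp add: le_fun_def)
  moreover have "\<exists>z\<in>X. a \<lless>\<^sub>R z \<and> b \<lless>\<^sub>R z"
    if X: "x \<in> X" "y \<in> X" and a: "a \<lless>\<^sub>R x" and b: "b \<lless>\<^sub>R y" for x y a b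
  proof -
    \<comment> \<open>Two intermediate elements are inserted: \<open>riesz_interpolation\<close>
      uses up the step from \<open>a1\<close> to \<open>a2\<close>, and the step from
      \<open>a\<close> to \<open>a1\<close> keeps \<open>a\<close> far below the
      interpolant.\<close>
    obtain a2 where a2: "a2 \<in> fractions" "a \<lless>\<^sub>R a2" "a2 \<lless>\<^sub>R x"
      using far_below_interpolate[OF a] by metis
    obtain a1 where a1: "a \<lless>\<^sub>R a1" "a1 \<lless>\<^sub>R a2"
      using far_below_interpolate[OF a2(2)] by metis
    obtain b2 where b2: "b2 \<in> fractions" "b \<lless>\<^sub>R b2" "b2 \<lless>\<^sub>R y"
      using far_below_interpolate[OF b] by metis
    obtain b1 where b1: "b \<lless>\<^sub>R b1" "b1 \<lless>\<^sub>R b2"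
      using far_below_interpolate[OF b2(2)] by metis
    have below: "a2 \<lless>\<^sub>R f" "a2 \<lless>\<^sub>R g" "b2 \<lless>\<^sub>R f" "b2 \<lless>\<^sub>R g"
      using a2(3) b2(3) X far_below_mono unfolding X_def by blast+
    obtain v where v: "v \<in> fractions" "a2 \<lless>\<^sub>R v" "b2 \<lless>\<^sub>R v" "v \<lless>\<^sub>R f"
      using far_below_common[OF below(1,3) f] by metis
    obtain w where w: "w \<in> fractions" "a2 \<lless>\<^sub>R w" "b2 \<lless>\<^sub>R w" "w \<lless>\<^sub>R g"
      using far_below_common[OF below(2,4) g] by metis
    obtain z where z: "z \<in> fractions" "a1 \<le> z" "b1 \<le> z" "z \<le> v" "z \<le> w"
      using riesz_interpolation[OF a1(2) b1(2) a2(1) v(1) w(1)] v(2,3) w(2,3) far_below_imp_le by metis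
    have "z \<in> X"
      unfolding X_def using z(4,5) far_below_imp_le[OF v(4)] far_below_imp_le[OF w(4)]
        fractions_subset_realification[OF z(1)] by auto
    then show ?thesis
      using far_below_mono[OF order_refl a1(1) z(2)] far_below_mono[OF order_refl b1(1) z(3)] by blast
  qed
  ultimately have "(\<lambda>l. SUP u\<in>X. u l) \<in> realification"
    by (intro directed_SUP_in_realification[OF D]) (auto simp: X_def)
  moreover have "(\<lambda>l. SUP u\<in>X. u l) \<le> f" "(\<lambda>l. SUP u\<in>X. u l) \<le> g"
    by (auto simp: X_def le_fun_def intro!: SUP_least)
  moreover have "u \<le> (\<lambda>l. SUP u\<in>X. u l)" if "u \<in> realification" "u \<le> f" "u \<le> g" for u
    using that by (auto simp: X_def le_fun_def intro!: SUP_upper)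
  ultimately show ?thesis
    by (auto simp: isGlb_def greatestP_def isLb_def setge_def setle_def)
qed

lemma realification_inf_props:
  fixes f g :: "'a functional \<Rightarrow> ennreal"
  assumes D: "countable D" "dense_subset (D :: 'a set)"
    and f: "f \<in> realification" and g: "g \<in> realification"
  shows "f \<sqinter>\<^sub>R g \<in> realification" "f \<sqinter>\<^sub>R g \<le> f" "f \<sqinter>\<^sub>R g \<le> g"
    "\<And>u. u \<in> realification \<Longrightarrow> u \<le> f \<Longrightarrow> u \<le> g \<Longrightarrow> u \<le> f \<sqinter>\<^sub>R g"
  using isGlb_realification[OF assms] realification_inf_eqI[OF isGlb_realification[OF assms]]
  by (auto simp: isGlb_def greatestP_def isLb_def setge_def setle_def)

lemma incseq_SUP_in_realification:
  fixes g :: "nat \<Rightarrow> 'a functional \<Rightarrow> ennreal"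
  assumes D: "countable D" "dense_subset (D :: 'a set)"
    and g: "\<And>n. g n \<in> realification" "incseq g"
  shows "(SUP n. g n) \<in> realification"
proof -
  have "(\<lambda>l. SUP f\<in>range g. f l) \<in> realification"
  proof (rule directed_SUP_in_realification[OF D])
    fix x y a b assume "x \<in> range g" "y \<in> range g" "a \<lless>\<^sub>R x" "b \<lless>\<^sub>R y"
    then obtain m n where mn: "a \<lless>\<^sub>R g m" "b \<lless>\<^sub>R g n"
      by blast
    have "g m \<le> g (max m n)" "g n \<le> g (max m n)"
      using g(2) by (auto simp: incseq_def)
    with mn show "\<exists>z\<in>range g. a \<lless>\<^sub>R z \<and> b \<lless>\<^sub>R z"
      using far_below_mono by blast
  qed (use g(1) in auto)
  then show ?thesis
    by (simp add: Sup_fun_def)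
qed

text \<open>By compactness, a fraction far below the infimum with the supremum is far below some
  \<open>g n\<close>, hence below the infimum of \<open>f\<close> and \<open>g n\<close>.\<close>

lemma realification_inf_SUP:
  fixes f :: "'a functional \<Rightarrow> ennreal"
  assumes D: "countable D" "dense_subset (D :: 'a set)"
    and f: "f \<in> realification" and g: "\<And>n. g n \<in> realification" "incseq g"
  shows "(SUP n. f \<sqinter>\<^sub>R g n) = f \<sqinter>\<^sub>R (SUP n. g n)"
proof (rule antisym)
  let ?S = "SUP n. g n"
  have S: "?S \<in> realification"
    by (rule incseq_SUP_in_realification[OF D g])
  note inf_S = realification_inf_props[OF D f S] and inf_g = realification_inf_props[OF D f g(1)]
  show "(SUP n. f \<sqinter>\<^sub>R g n) \<le> f \<sqinter>\<^sub>R ?S"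
  proof (rule SUP_least)
    fix n
    have "g n \<le> ?S"
      by (rule SUP_upper) simp
    then show "f \<sqinter>\<^sub>R g n \<le> f \<sqinter>\<^sub>R ?S"
      using inf_S(4)[OF inf_g(1,2)] inf_g(3) by (meson order_trans)
  qed
  show "f \<sqinter>\<^sub>R ?S \<le> (SUP n. f \<sqinter>\<^sub>R g n)"
  proof (rule le_funI, rule realification_leI[OF inf_S(1)])
    fix l a assume a: "a \<in> fractions" "a \<lless>\<^sub>R f \<sqinter>\<^sub>R ?S"
    have "(f \<sqinter>\<^sub>R ?S) l \<le> (SUP n. g n l)" for l
      using le_funD[OF inf_S(3), of l] by (simp add: SUP_apply image_image)
    then obtain n where n: "a \<lless>\<^sub>R g n"
      using far_below_SUP[OF a(2) g(2,1)] by blast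
    have "a \<le> f \<sqinter>\<^sub>R g n"
      by (rule inf_g(4)[OF fractions_subset_realification[OF a(1)]
          order_trans[OF far_below_imp_le[OF a(2)] inf_S(2)] far_below_imp_le[OF n]])
    also have "\<dots> \<le> (SUP n. f \<sqinter>\<^sub>R g n)"
      by (rule SUP_upper) simp
    finally show "a l \<le> (SUP n. f \<sqinter>\<^sub>R g n) l"
      by (rule le_funD)
  qed
qed

text \<open>Split \<open>e\<close> along \<open>f + h\<close> into \<open>f1 + h1\<close>. Since
  \<open>f1 + h1 \<le> g + h\<close>, cancelling an approximation \<open>\<eta>\<close> of
  \<open>h1\<close> leaves \<open>f1\<close> below \<open>g\<close> plus the complement
  \<open>h3\<close> of \<open>\<eta>\<close> in \<open>h\<close>, up to an error; O6 then extracts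
  from \<open>f1\<close> a part \<open>u\<close> below \<open>g\<close>.\<close>

lemma far_below_common_add:
  fixes e f g h :: "'a functional \<Rightarrow> ennreal"
  assumes "a \<lless>\<^sub>R e" and mem: "f \<in> fractions" "g \<in> fractions" "h \<in> fractions"
    and le: "\<And>l. e l \<le> f l + h l" "\<And>l. e l \<le> g l + h l" and \<epsilon>: "0 < \<epsilon>" "\<epsilon> \<in> \<rat>"
  obtains u where "u \<in> fractions" "u \<le> f" "u \<le> g" "\<And>l. a l \<le> u l + (h l + ennreal \<epsilon> * h l)"
proof -
  obtain e' where e': "a \<lless>\<^sub>R e'" "e' \<lless>\<^sub>R e"
    using far_below_interpolate[OF assms(1)] by metis
  obtain f1 h1 where f1: "f1 \<in> fractions" "h1 \<in> fractions" "f1 \<le> f" "h1 \<le> h"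
    "\<And>l. f1 l + h1 l \<le> e l" "\<And>l. e' l \<le> f1 l + h1 l"
    using riesz_decomposition[OF e'(2) mem(1,3) le(1)] by metis
  obtain f1' h1' where f1': "f1' \<lless>\<^sub>R f1" "h1' \<lless>\<^sub>R h1" "\<And>l. a l \<le> f1' l + h1' l"
    using far_below_add_split[OF e'(1) f1(1,2,6)] by metis
  obtain \<eta> where \<eta>: "\<eta> \<in> fractions" "h1' \<le> \<eta>" "\<eta> \<le> h1"
    "\<And>g. g \<in> fractions \<Longrightarrow> h1 \<le> g \<Longrightarrow>
      \<exists>u\<in>fractions. (\<forall>l. \<eta> l + u l \<le> g l) \<and> (\<forall>l. g l \<le> \<eta> l + u l + ennreal \<epsilon> * h1 l)"
    using approx_complement[OF f1'(2) \<epsilon>(1)] by metis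
  obtain h3 where h3: "h3 \<in> fractions" "\<And>l. \<eta> l + h3 l \<le> h l" "\<And>l. h l \<le> \<eta> l + h3 l + ennreal \<epsilon> * h1 l"
    using \<eta>(4)[OF mem(3) f1(4)] by metis
  have f1_le: "f1 l \<le> g l + (h3 l + ennreal \<epsilon> * h1 l)" for l
  proof (rule ennreal_le_of_add_le)
    have "\<eta> l + f1 l \<le> f1 l + h1 l"
      using add_left_mono[OF le_funD[OF \<eta>(3), of l], of "f1 l"] by (simp add: add.commute)
    also have "\<dots> \<le> g l + h l"
      using f1(5) le(2) by (rule order_trans)
    also have "\<dots> \<le> g l + (\<eta> l + h3 l + ennreal \<epsilon> * h1 l)"
      by (intro add_left_mono h3(3))
    finally show "\<eta> l + f1 l \<le> \<eta> l + (g l + (h3 l + ennreal \<epsilon> * h1 l))"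
      by (simp add: ac_simps)
    show "g l + (h3 l + ennreal \<epsilon> * h1 l) = top" if "\<eta> l = top"
      using le_funD[OF \<eta>(3), of l] that \<epsilon>(1) by (auto simp: top_unique ennreal_mult_top)
  qed
  obtain u v where u: "u \<in> fractions" "\<And>l. f1' l \<le> u l + v l" "u \<le> g" "u \<le> f1"
    and v: "v \<le> (\<lambda>l. h3 l + ennreal \<epsilon> * h1 l)"
    using fractions_O6[OF f1'(1) mem(2) fractions_add[OF h3(1) fractions_scale[OF f1(2) \<epsilon>(2) less_imp_le[OF \<epsilon>(1)]]] f1_le]
    by metis
  show ?thesis
  proof (rule that[OF u(1) order_trans[OF u(4) f1(3)] u(3)])
    fix l
    have "f1' l \<le> u l + (h3 l + ennreal \<epsilon> * h1 l)"
      using u(2)[of l] add_left_mono[OF le_funD[OF v, of l], of "u l"] by (rule order_trans)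
    then have "a l \<le> (u l + (h3 l + ennreal \<epsilon> * h1 l)) + \<eta> l"
      using order_trans[OF f1'(3) add_mono[OF _ le_funD[OF \<eta>(2)]]] by blast
    also have "\<dots> = u l + ((\<eta> l + h3 l) + ennreal \<epsilon> * h1 l)"
      by (simp add: ac_simps)
    also have "\<dots> \<le> u l + (h l + ennreal \<epsilon> * h l)"
      using le_funD[OF f1(4), of l] by (intro add_left_mono add_mono h3(2) mult_left_mono) auto
    finally show "a l \<le> u l + (h l + ennreal \<epsilon> * h l)" .
  qed
qed

text \<open>One inequality is formal. For the other, compactness replaces \<open>f\<close>,
  \<open>g\<close>, \<open>h\<close> by fractions, and \<open>far_below_common_add\<close> gives the
  bound up to \<open>d\<close> times \<open>h\<close>.\<close>

lemma realification_inf_add: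
  fixes f g h :: "'a functional \<Rightarrow> ennreal"
  assumes D: "countable D" "dense_subset (D :: 'a set)"
    and f: "f \<in> realification" and g: "g \<in> realification" and h: "h \<in> realification"
  shows "(\<lambda>l. (f \<sqinter>\<^sub>R g) l + h l) = (\<lambda>l. f l + h l) \<sqinter>\<^sub>R (\<lambda>l. g l + h l)"
proof (rule antisym)
  note fh = realification_add[OF f h] and gh = realification_add[OF g h]
  note inf = realification_inf_props[OF D f g] and inf_h = realification_inf_props[OF D fh gh]
  show "(\<lambda>l. (f \<sqinter>\<^sub>R g) l + h l) \<le> (\<lambda>l. f l + h l) \<sqinter>\<^sub>R (\<lambda>l. g l + h l)"
    using inf(2,3) by (intro inf_h(4) realification_add[OF inf(1) h]) (auto simp: le_fun_def)
  show "(\<lambda>l. f l + h l) \<sqinter>\<^sub>R (\<lambda>l. g l + h l) \<le> (\<lambda>l. (f \<sqinter>\<^sub>R g) l + h l)"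
  proof (rule le_funI, rule realification_leI[OF inf_h(1)])
    fix l a assume a: "a \<lless>\<^sub>R (\<lambda>l. f l + h l) \<sqinter>\<^sub>R (\<lambda>l. g l + h l)"
    obtain e where e: "a \<lless>\<^sub>R e" "e \<lless>\<^sub>R (\<lambda>l. f l + h l) \<sqinter>\<^sub>R (\<lambda>l. g l + h l)"
      using far_below_interpolate[OF a] by metis
    obtain F where F: "incseq F" "\<And>i. F i \<in> fractions" "\<And>l. f l = (SUP i::nat. F i l)" "\<And>i. F i \<le> f"
      using realification_fractionsE[OF f] by metis
    obtain G where G: "incseq G" "\<And>i. G i \<in> fractions" "\<And>l. g l = (SUP i::nat. G i l)" "\<And>i. G i \<le> g"
      using realification_fractionsE[OF g] by metis
    obtain H where H: "incseq H" "\<And>i. H i \<in> fractions" "\<And>l. h l = (SUP i::nat. H i l)" "\<And>i. H i \<le> h"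
      using realification_fractionsE[OF h] by metis
    \<comment> \<open>Stated for a general \<open>K\<close> to serve \<open>F\<close> and
      \<open>G\<close> alike, and for all large \<open>m\<close> so that both hold at one
      index.\<close>
    have ex: "\<exists>n. \<forall>m\<ge>n. \<forall>l. e l \<le> K m l + H m l"
      if K: "incseq K" "\<And>i. K i \<in> fractions" "\<And>l. k l = (SUP i::nat. K i l)"
        and k: "(\<lambda>l. f l + h l) \<sqinter>\<^sub>R (\<lambda>l. g l + h l) \<le> (\<lambda>l. k l + h l)" for K k
    proof -
      have inc: "incseq (\<lambda>i l. K i l + H i l)"
        using K(1) H(1) by (auto simp: incseq_def le_fun_def intro: add_mono)
      have real: "(\<lambda>l. K i l + H i l) \<in> realification" for i
        by (intro fractions_subset_realification fractions_add K(2) H(2))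
      have le: "((\<lambda>l. f l + h l) \<sqinter>\<^sub>R (\<lambda>l. g l + h l)) l \<le> (SUP i. K i l + H i l)" for l
        using le_funD[OF k, of l] K(1) H(1) unfolding K(3) H(3)
        by (subst ennreal_SUP_add) (auto simp: incseq_def le_fun_def)
      obtain n where "e \<lless>\<^sub>R (\<lambda>l. K n l + H n l)"
        by (rule far_below_SUP[OF e(2) inc real le])
      then have "e l \<le> K n l + H n l" for l
        using far_below_imp_le by (auto simp: le_fun_def)
      moreover have "K n l + H n l \<le> K m l + H m l" if "n \<le> m" for m l
        using inc that by (auto simp: incseq_def le_fun_def)
      ultimately show ?thesis
        by (meson order_trans)
    qed
    obtain n1 n2 where "\<forall>m\<ge>n1. \<forall>l. e l \<le> F m l + H m l" "\<forall>m\<ge>n2. \<forall>l. e l \<le> G m l + H m l"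
      using ex[OF F(1-3) inf_h(2)] ex[OF G(1-3) inf_h(3)] by blast
    then obtain n where n: "\<And>l. e l \<le> F n l + H n l" "\<And>l. e l \<le> G n l + H n l"
      by (metis max.cobounded1 max.cobounded2)
    show "a l \<le> (f \<sqinter>\<^sub>R g) l + h l"
    proof (rule ennreal_le_mult_epsilon)
      fix d :: real assume d: "0 < d" "d \<in> \<rat>"
      obtain u where u: "u \<in> fractions" "u \<le> F n" "u \<le> G n"
        "\<And>l. a l \<le> u l + (H n l + ennreal d * H n l)"
        using far_below_common_add[OF e(1) F(2) G(2) H(2) n d] by metis
      have "u \<le> f \<sqinter>\<^sub>R g"
        by (rule inf(4)[OF fractions_subset_realification[OF u(1)]
            order_trans[OF u(2) F(4)] order_trans[OF u(3) G(4)]])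
      \<comment> \<open>The error is enlarged to \<open>d\<close> times the whole right-hand side,
        the form that \<open>ennreal_le_mult_epsilon\<close> removes.\<close>
      then have "u l + (H n l + ennreal d * H n l) \<le>
          (f \<sqinter>\<^sub>R g) l + (h l + ennreal d * ((f \<sqinter>\<^sub>R g) l + h l))"
        using H(4)[of n] by (intro add_mono mult_left_mono) (auto simp: le_fun_def add_increasing)
      with u(4)[of l] show "a l \<le> (f \<sqinter>\<^sub>R g) l + h l + ennreal d * ((f \<sqinter>\<^sub>R g) l + h l)"
        unfolding add.assoc by (rule order_trans)
    qed
  qed
qed

end

theorem theorem4p2p2:
  assumes "axiom_O1 TYPE('a::ordered_semigroup)"
    and "axiom_O2 TYPE('a)"
    and "axiom_O3 TYPE('a)"
    and "axiom_O4 TYPE('a)"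
    and "axiom_O5 TYPE('a)"
    and "axiom_O6 TYPE('a)"
    and "\<exists>D :: 'a set. countable D \<and> dense_subset D"
  shows
    "(\<forall>f \<in> (realification :: ('a functional \<Rightarrow> ennreal) set). \<forall>g \<in> realification.
        \<exists>h. isGlb realification {f, g} h) \<and>
     (\<forall>f \<in> (realification :: ('a functional \<Rightarrow> ennreal) set).
        \<forall>g :: nat \<Rightarrow> 'a functional \<Rightarrow> ennreal.
        (\<forall>n. g n \<in> realification) \<and> incseq g \<longrightarrow>
        (SUP n. g n) \<in> realification \<and>
        (SUP n. f \<sqinter>\<^sub>R g n) = f \<sqinter>\<^sub>R (SUP n. g n)) \<and>
     (\<forall>f \<in> (realification :: ('a functional \<Rightarrow> ennreal) set).
        \<forall>g \<in> realification. \<forall>h \<in> realification.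
        (\<lambda>l. (f \<sqinter>\<^sub>R g) l + h l) = (\<lambda>l. f l + h l) \<sqinter>\<^sub>R (\<lambda>l. g l + h l))"
proof -
  interpret cu_semigroup "TYPE('a)"
    using assms by unfold_locales
  obtain D :: "'a set" where D: "countable D" "dense_subset D"
    using assms(7) by blast
  show ?thesis
    by (intro conjI ballI allI impI)
       (blast intro: isGlb_realification[OF D] incseq_SUP_in_realification[OF D]
          realification_inf_SUP[OF D] realification_inf_add[OF D])+
qed

end
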